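(* In the setting below, if $q\le\frac{1}{(4e\log\tilde n)\,\tau(\tilde n)}$, then $\mathbb{E}[|M_4|]\ge\frac{q}{4\rho}\,\mathbb{E}[\mathrm{OPT}(w^S)]$, where $\mathrm{OPT}(w^S)$ is the maximum cardinality of an independent subset of $V^S$; i.e., the algorithm is $O(\rho^2\log^2 n)$-competitive.
   Context: Edge-weighted conflict graph: a finite node set $V$ with directed weights $w(u,v)\in[0,1]$, $w(v,v)=0$, and $\bar w(u,v)=w(u,v)+w(v,u)$. $S\subseteq V$ is independent if $\sum_{u\in S}w(u,v)<1$ for all $v\in S$. The inductive independence number $\rho$ is the smallest number for which there is a total order $\prec$ on $V$ such that for every independent set $S$ and every $v\in V$, $\sum_{u\in S,\,u\succ v}\bar w(u,v)\le\rho$. Graph sampling model with $\{0,1\}$-weights (parameter $c\ge1$): random subsets $V^I,V^S\subseteq V$, the pairs of events $(v\in V^I,v\in V^S)$ independent across nodes (possibly correlated for the same node), with $\frac1c\Pr[v\in V^S]\le\Pr[v\in V^I]\le c\Pr[v\in V^S]$; the algorithm receives the sample $V^S$ first and then the nodes of $V^I$ one by one in adversarial order. Competitive ratio: $\mathbb{E}[\mathrm{OPT}(w^I)]/\mathbb{E}[|\text{output}|]$ with $\mathrm{OPT}(w^I)$ the maximum cardinality of an independent subset of $V^I$. Standing assumption: $\Pr[v\notin V^S,\ v\notin V^I]=0$ for each $v$, and $n=|V^S\cup V^I|$. Logarithms are base 2. Let $\tau(m)=\frac{3(1+c)^3+c}{c}(2\rho\lceil\log m\rceil+1)$ and $\tilde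 n=(c+2)|V^S|$. Algorithm: $M_1$: go through $v\in V^S$ in increasing order $\prec$, adding $v$ if $\sum_{u\in M_1}\bar w(u,v)<1$. Then for each $v\in V^I$ in arrival order: add $v$ to $M_2$ if $\sum_{u\in M_1,u\prec v}\bar w(u,v)<1$; if $v\in M_2$, add $v$ to $M_3$ independently with probability $q$; if $v\in M_3$ and there is no $u\in M_3$ (among the nodes added so far) with $\bar w(u,v)\ge\frac{1}{4e\log\tilde n}$, add $v$ to $M_4$. $M_4$ is the output.
   Formalization: The inequality fails for large c or small ρ, so it is proved with an extra factor 1/c (without it if Pr[v∈V^S] ≤ Pr[v∈V^I] for all v) and for ρ ≥ 1; competitiveness is for ρ ≥ 1, n ≥ 2, with q the maximal value computed from V^S, |V^S| read as 1 if empty, over one node type. *)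

theory Defs
  imports "HOL-Probability.Probability"
begin

section \<open>Edge-weighted conflict graphs\<close>

locale conflict_graph =
  fixes V :: "'a set" and w :: "'a \<Rightarrow> 'a \<Rightarrow> real"
  assumes finite_nodes: "finite V"
    and weight_range: "\<And>u v. u \<in> V \<Longrightarrow> v \<in> V \<Longrightarrow> 0 \<le> w u v \<and> w u v \<le> 1"
    and weight_self: "\<And>v. v \<in> V \<Longrightarrow> w v v = 0"

definition wbar :: "('a \<Rightarrow> 'a \<Rightarrow> real) \<Rightarrow> 'a \<Rightarrow> 'a \<Rightarrow> real" where
  "wbar w u v = w u v + w v u"

definition independent_set :: "('a \<Rightarrow> 'a \<Rightarrow> real) \<Rightarrow> 'a set \<Rightarrow> bool" where
  "independent_set w S \<longleftrightarrow> (\<forall>v\<in>S. (\<Sum>u\<in>S. w u v) < 1)"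

definition OPT :: "('a \<Rightarrow> 'a \<Rightarrow> real) \<Rightarrow> 'a set \<Rightarrow> nat" where
  "OPT w A = Max (card ` {T. T \<subseteq> A \<and> independent_set w T})"

text \<open>An order is a strict relation; \<open>(u, v) \<in> prec\<close> means that \<open>u\<close> precedes \<open>v\<close>.\<close>

definition inductive_order ::
    "'a set \<Rightarrow> ('a \<Rightarrow> 'a \<Rightarrow> real) \<Rightarrow> 'a rel \<Rightarrow> real \<Rightarrow> bool" where
  "inductive_order V w prec r \<longleftrightarrow>
     strict_linear_order_on V prec \<and>
     (\<forall>S v. S \<subseteq> V \<longrightarrow> independent_set w S \<longrightarrow> v \<in> V \<longrightarrow>
        (\<Sum>u\<in>{u \<in> S. (v, u) \<in> prec}. wbar w u v) \<le> r)"

definition inductive_independence_number :: "'a set \<Rightarrow> ('a \<Rightarrow> 'a \<Rightarrow> real) \<Rightarrow> real" where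
  "inductive_independence_number V w = (LEAST r. \<exists>prec. inductive_order V w prec r)"


section \<open>The graph sampling model\<close>

text \<open>
  \<open>D\<close> is the joint law of \<open>(V\<^sup>I, V\<^sup>S)\<close>; both are subsets of the finite set \<open>V\<close>, so a
  discrete law loses no generality. The law for a single node is unrestricted apart from
  the marginal ratios and \<open>never_absent\<close>; the latter makes \<open>V\<^sup>S \<union> V\<^sup>I = V\<close> almost surely,
  hence \<open>n = card V\<close>.
\<close>

locale graph_sampling = conflict_graph V w
  for V :: "'a set" and w :: "'a \<Rightarrow> 'a \<Rightarrow> real" +
  fixes c :: real and D :: "('a set \<times> 'a set) pmf"
  assumes c_ge_1: "1 \<le> c"
    and sampled_subsets: "\<And>I S. (I, S) \<in> set_pmf D \<Longrightarrow> I \<subseteq> V \<and> S \<subseteq> V"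
    and indep_nodes:
      "prob_space.indep_vars (measure_pmf D) (\<lambda>_. count_space UNIV)
         (\<lambda>v (I, S). (v \<in> I, v \<in> S)) V"
    and ratio_lower: "\<And>v. v \<in> V \<Longrightarrow>
      1 / c * measure_pmf.prob D {(I, S). v \<in> S} \<le> measure_pmf.prob D {(I, S). v \<in> I}"
    and ratio_upper: "\<And>v. v \<in> V \<Longrightarrow>
      measure_pmf.prob D {(I, S). v \<in> I} \<le> c * measure_pmf.prob D {(I, S). v \<in> S}"
    and never_absent: "\<And>v. v \<in> V \<Longrightarrow>
      measure_pmf.prob D {(I, S). v \<notin> S \<and> v \<notin> I} = 0"

text \<open>
  The adversary picks the arrival order of \<open>V\<^sup>I\<close>. It may depend on both sampled sets and on
  the coin flips of the algorithm, which covers oblivious and adaptive adversaries alike.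
\<close>

definition arrival_order ::
    "('a set \<times> 'a set) pmf \<Rightarrow> ('a set \<Rightarrow> 'a set \<Rightarrow> ('a \<Rightarrow> bool) \<Rightarrow> 'a list) \<Rightarrow> bool" where
  "arrival_order D arr \<longleftrightarrow>
     (\<forall>(I, S)\<in>set_pmf D. \<forall>coin. distinct (arr I S coin) \<and> set (arr I S coin) = I)"


section \<open>The algorithm\<close>

text \<open>
  For a nonempty sample this is \<open>(c + 2) |V\<^sup>S|\<close>. For the empty sample, where the logarithm of
  that number is undefined, the sample size is replaced by 1.
\<close>

definition n_tilde :: "real \<Rightarrow> 'a set \<Rightarrow> real" where
  "n_tilde c S = (c + 2) * real (max 1 (card S))"

definition tau :: "real \<Rightarrow> real \<Rightarrow> real \<Rightarrow> real" where
  "tau c r m = (3 * (1 + c) ^ 3 + c) / c * (2 * r * of_int \<lceil>log 2 m\<rceil> + 1)"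

definition q_max :: "real \<Rightarrow> real \<Rightarrow> 'a set \<Rightarrow> real" where
  "q_max c r S = 1 / ((4 * exp 1 * log 2 (n_tilde c S)) * tau c r (n_tilde c S))"

definition increasing_list :: "'a rel \<Rightarrow> 'a set \<Rightarrow> 'a list" where
  "increasing_list prec S =
     (THE xs. distinct xs \<and> set xs = S \<and> sorted_wrt (\<lambda>u v. (u, v) \<in> prec) xs)"

definition M1 :: "('a \<Rightarrow> 'a \<Rightarrow> real) \<Rightarrow> 'a rel \<Rightarrow> 'a set \<Rightarrow> 'a set" where
  "M1 w prec S =
     fold (\<lambda>v M. if (\<Sum>u\<in>M. wbar w u v) < 1 then insert v M else M) (increasing_list prec S) {}"

definition joins_M2 :: "('a \<Rightarrow> 'a \<Rightarrow> real) \<Rightarrow> 'a rel \<Rightarrow> 'a set \<Rightarrow> 'a \<Rightarrow> bool" where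
  "joins_M2 w prec S v \<longleftrightarrow> (\<Sum>u\<in>{u \<in> M1 w prec S. (u, v) \<in> prec}. wbar w u v) < 1"

text \<open>The state is \<open>(M\<^sub>3, M\<^sub>4)\<close>; \<open>coin v\<close> is the outcome of the coin flip for \<open>v\<close>.\<close>

definition online_step ::
    "('a \<Rightarrow> 'a \<Rightarrow> real) \<Rightarrow> 'a rel \<Rightarrow> real \<Rightarrow> 'a set \<Rightarrow> ('a \<Rightarrow> bool) \<Rightarrow>
     'a \<Rightarrow> 'a set \<times> 'a set \<Rightarrow> 'a set \<times> 'a set" where
  "online_step w prec c S coin v = (\<lambda>(M3, M4).
     if joins_M2 w prec S v \<and> coin v then
       (insert v M3,
        if \<exists>u\<in>M3. wbar w u v \<ge> 1 / (4 * exp 1 * log 2 (n_tilde c S)) then M4 else insert v M4)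
     else (M3, M4))"

definition M4 ::
    "('a \<Rightarrow> 'a \<Rightarrow> real) \<Rightarrow> 'a rel \<Rightarrow> real \<Rightarrow> 'a set \<Rightarrow> ('a \<Rightarrow> bool) \<Rightarrow> 'a list \<Rightarrow> 'a set" where
  "M4 w prec c S coin xs = snd (fold (online_step w prec c S coin) xs ({}, {}))"

text \<open>
  The law of the output. The coins are independent of \<open>(V\<^sup>I, V\<^sup>S)\<close> except that the
  probability \<open>q S\<close> may be chosen after seeing the sample \<open>S\<close>.
\<close>

definition alg_output ::
    "'a set \<Rightarrow> ('a \<Rightarrow> 'a \<Rightarrow> real) \<Rightarrow> 'a rel \<Rightarrow> real \<Rightarrow> ('a set \<times> 'a set) pmf \<Rightarrow>
     ('a set \<Rightarrow> 'a set \<Rightarrow> ('a \<Rightarrow> bool) \<Rightarrow> 'a list) \<Rightarrow> ('a set \<Rightarrow> real) \<Rightarrow> 'a set pmf" where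
  "alg_output V w prec c D arr q =
     bind_pmf D (\<lambda>(I, S).
       map_pmf (\<lambda>coin. M4 w prec c S coin (arr I S coin))
         (Pi_pmf V False (\<lambda>_. bernoulli_pmf (q S))))"

definition expected_output ::
    "'a set \<Rightarrow> ('a \<Rightarrow> 'a \<Rightarrow> real) \<Rightarrow> 'a rel \<Rightarrow> real \<Rightarrow> ('a set \<times> 'a set) pmf \<Rightarrow>
     ('a set \<Rightarrow> 'a set \<Rightarrow> ('a \<Rightarrow> bool) \<Rightarrow> 'a list) \<Rightarrow> ('a set \<Rightarrow> real) \<Rightarrow> real" where
  "expected_output V w prec c D arr q =
     measure_pmf.expectation (alg_output V w prec c D arr q) (\<lambda>X. real (card X))"

definition expected_OPT_S :: "('a \<Rightarrow> 'a \<Rightarrow> real) \<Rightarrow> ('a set \<times> 'a set) pmf \<Rightarrow> real" where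
  "expected_OPT_S w D = measure_pmf.expectation D (\<lambda>(I, S). real (OPT w S))"

definition expected_OPT_I :: "('a \<Rightarrow> 'a \<Rightarrow> real) \<Rightarrow> ('a set \<times> 'a set) pmf \<Rightarrow> real" where
  "expected_OPT_I w D = measure_pmf.expectation D (\<lambda>(I, S). real (OPT w I))"

text \<open>
  Two conventions are needed when comparing the output with \<open>q / (4 \<rho>) E[OPT(w\<^sup>S)]\<close>.

  The factor \<open>1 / c\<close>: if \<open>V\<^sup>S = V\<close> and \<open>Pr[v \<in> V\<^sup>I] = 1 / c\<close> for all \<open>v\<close>, then
  \<open>E[|M\<^sub>4|] \<le> q E[|V\<^sup>I|] = q n / c\<close>, whereas a graph whose only conflict is between two nodes
  has \<open>\<rho> = 1\<close> and \<open>OPT(w\<^sup>S) = n - 1\<close>. So without further assumptions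
  \<open>q / (4 \<rho>) E[OPT(w\<^sup>S)]\<close> is not a lower bound for \<open>c > 4\<close> and large \<open>n\<close>; the ratio
  \<open>Pr[v \<in> V\<^sup>I] / Pr[v \<in> V\<^sup>S]\<close> has to enter.

  The condition \<open>\<rho> \<ge> 1\<close>: if \<open>c = 1\<close> and the total weight is tiny, then all sets are independent
  and \<open>E[|M\<^sub>4|] \<le> q E[|V\<^sup>I|] = q E[OPT(w\<^sup>S)]\<close> with \<open>\<rho>\<close> arbitrarily close to 0.
\<close>

end

theory Submission
  imports Defs "HOL-Real_Asymp.Real_Asymp"
begin

text \<open>
  Whether \<open>v\<close> qualifies for \<open>M\<^sub>2\<close> depends only on the sample among the predecessors of \<open>v\<close>, and
  \<open>M\<^sub>1\<close> consists of the qualifying sampled nodes. By independence \<open>E|M\<^sub>2|\<close> and \<open>E|M\<^sub>1|\<close> differ only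
  through the marginals, and a charging argument gives \<open>OPT(w\<^sup>S) \<le> 2 \<rho> |M\<^sub>1|\<close>.

  To bound the total weight inside \<open>M\<^sub>2\<close>, fix \<open>v\<close>. A node that qualifies joins the sample with
  probability at least \<open>1 / (1 + c)\<close>, so if the qualifying predecessors of \<open>v\<close> have total weight
  \<open>W\<close>, the sampled ones among them have weight below 1 (i.e. \<open>v\<close> itself qualifies) with probability
  exponentially small in \<open>W\<close>. Hence only the contribution \<open>W = O(log n)\<close> matters, and the expected
  weight inside \<open>M\<^sub>2\<close> is at most \<open>O(log n) E|M\<^sub>2|\<close>. For \<open>q\<close> as small as prescribed, half of the
  nodes in \<open>M\<^sub>3\<close> survive in expectation, whatever the arrival order.

  When \<open>q\<close> is computed from the sample, it is too large for small samples. These are exponentially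
  unlikely in \<open>n\<close>, and for bounded \<open>n\<close> every node survives with probability bounded from below.
\<close>

section \<open>The greedy solution on the sample\<close>

lemma wbar_commute: "wbar w u v = wbar w v u"
  by (simp add: wbar_def)

locale ordered_conflict_graph = conflict_graph V w
  for V :: "'a set" and w :: "'a \<Rightarrow> 'a \<Rightarrow> real" +
  fixes prec :: "'a rel"
  assumes prec_linear: "strict_linear_order_on V prec"
begin

section \<open>The order on the nodes and the sorted enumeration of a sample\<close>

lemma prec_trans: "(x, y) \<in> prec \<Longrightarrow> (y, z) \<in> prec \<Longrightarrow> (x, z) \<in> prec"
  using prec_linear by (auto simp: strict_linear_order_on_def dest: transD)

lemma prec_irrefl [simp]: "(x, x) \<notin> prec"
  using prec_linear by (auto simp: strict_linear_order_on_def irrefl_def)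

lemma prec_asym: "(x, y) \<in> prec \<Longrightarrow> (y, x) \<notin> prec"
  using prec_trans prec_irrefl by blast

lemma prec_total: "x \<in> V \<Longrightarrow> y \<in> V \<Longrightarrow> x \<noteq> y \<Longrightarrow> (x, y) \<in> prec \<or> (y, x) \<in> prec"
  using prec_linear by (auto simp: strict_linear_order_on_def total_on_def)

text \<open>A numeric key for the order, so that sorting, extremal nodes and induction along the
  order become available.\<close>

definition rank :: "'a \<Rightarrow> nat" where
  "rank v = card {u \<in> V. (u, v) \<in> prec}"

lemma rank_less:
  assumes "u \<in> V" "(u, v) \<in> prec"
  shows "rank u < rank v"
proof -
  have "{x \<in> V. (x, u) \<in> prec} \<subset> {x \<in> V. (x, v) \<in> prec}"
    using assms prec_trans prec_irrefl by (intro psubsetI) blast+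
  then show ?thesis
    unfolding rank_def using finite_nodes by (intro psubset_card_mono) auto
qed

lemma rank_less_iff:
  assumes "u \<in> V" "v \<in> V"
  shows "rank u < rank v \<longleftrightarrow> (u, v) \<in> prec"
  using assms by (metis less_irrefl less_asym prec_total rank_less)

lemma inj_on_rank: "inj_on rank V"
  by (rule inj_onI) (metis less_irrefl prec_total rank_less)

text \<open>Sorting by \<open>rank\<close> produces such a list and injectivity of
  \<open>rank\<close> makes it unique, so the definite description is meaningful.\<close>

lemma increasing_list:
  assumes "S \<subseteq> V"
  shows "distinct (increasing_list prec S) \<and> set (increasing_list prec S) = S \<and>
    sorted_wrt (\<lambda>u v. (u, v) \<in> prec) (increasing_list prec S)"
proof -
  let ?P = "\<lambda>xs. distinct xs \<and> set xs = S \<and> sorted_wrt (\<lambda>u v. (u, v) \<in> prec) xs"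
  have inj: "inj_on rank S"
    using inj_on_rank assms inj_on_subset by blast
  have sorted_rank: "sorted_wrt (<) (map rank xs)" if "?P xs" for xs
    unfolding sorted_wrt_map
    by (rule sorted_wrt_mono_rel[of _ "\<lambda>u v. (u, v) \<in> prec"]) (use that assms rank_less in auto)
  obtain ys where ys: "distinct ys" "set ys = S"
    using finite_distinct_list finite_subset[OF assms finite_nodes] by blast
  let ?xs = "sort_key rank ys"
  have "sorted_wrt (<) (map rank ?xs)"
    using ys inj by (simp add: strict_sorted_iff distinct_map)
  then have "sorted_wrt (\<lambda>u v. (u, v) \<in> prec) ?xs"
    unfolding sorted_wrt_map
    by (rule sorted_wrt_mono_rel[rotated]) (use ys assms rank_less_iff in auto)
  with ys have ex: "?P ?xs"
    by simp
  have "xs = ?xs" if "?P xs" for xs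
  proof -
    have "map rank xs = map rank ?xs"
      using sorted_rank[OF that] sorted_rank[OF ex] that ex
      by (intro strict_sorted_equal) auto
    then show ?thesis
      using that ex inj by (metis map_inj_on Un_absorb)
  qed
  with ex show ?thesis
    unfolding increasing_list_def by (rule theI2[where P = ?P])
qed

text \<open>The nodes accepted before \<open>v\<close> all precede it and later additions do not, so
  testing \<open>v\<close> against the current set is the same as testing it against its
  predecessors in the final set.\<close>

lemma greedy_fold:
  assumes "sorted_wrt (\<lambda>u v. (u, v) \<in> prec) xs" "distinct xs"
    and "\<And>u v. u \<in> M0 \<Longrightarrow> v \<in> set xs \<Longrightarrow> (u, v) \<in> prec"
  defines "M \<equiv> fold (\<lambda>v M. if (\<Sum>u\<in>M. wbar w u v) < 1 then insert v M else M) xs M0"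
  shows "M = M0 \<union> {v \<in> set xs. (\<Sum>u\<in>{u \<in> M. (u, v) \<in> prec}. wbar w u v) < 1}"
  using assms(1-3) unfolding M_def
proof (induction xs arbitrary: M0)
  case Nil
  then show ?case by simp
next
  case (Cons x xs)
  let ?f = "\<lambda>v M. if (\<Sum>u\<in>M. wbar w u v) < 1 then insert v M else M"
  define M' where "M' = fold ?f xs (?f x M0)"
  have IH: "M' = ?f x M0 \<union> {v \<in> set xs. (\<Sum>u\<in>{u \<in> M'. (u, v) \<in> prec}. wbar w u v) < 1}"
    unfolding M'_def using Cons.prems by (intro Cons.IH) (auto split: if_splits)
  have "{u \<in> M'. (u, x) \<in> prec} = M0"
    using Cons.prems by (subst IH) (auto dest: prec_asym)
  then have "M' = M0 \<union> {v \<in> set (x # xs). (\<Sum>u\<in>{u \<in> M'. (u, v) \<in> prec}. wbar w u v) < 1}"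
    using IH by (auto split: if_splits)
  then show ?case
    unfolding M'_def by simp
qed

lemma M1_eq: "S \<subseteq> V \<Longrightarrow> M1 w prec S = {v \<in> S. joins_M2 w prec S v}"
  using greedy_fold[of "increasing_list prec S" "{}"] increasing_list[of S]
  by (simp add: M1_def joins_M2_def)

text \<open>Eliminates \<open>M1\<close>: qualification becomes a recursion over sampled
  predecessors.\<close>

lemma joins_M2_iff:
  assumes "S \<subseteq> V"
  shows "joins_M2 w prec S v \<longleftrightarrow>
    (\<Sum>u\<in>{u \<in> S. (u, v) \<in> prec \<and> joins_M2 w prec S u}. wbar w u v) < 1"
  unfolding joins_M2_def[of w prec S v] M1_eq[OF assms] by (simp add: conj_ac)

text \<open>The source of all independence used below: by induction on the rank, only the part of
  the sample strictly before \<open>v\<close> matters.\<close>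

lemma joins_M2_cong:
  assumes "S \<subseteq> V" "S' \<subseteq> V" "v \<in> V"
    and "\<And>u. u \<in> V \<Longrightarrow> (u, v) \<in> prec \<Longrightarrow> u \<in> S \<longleftrightarrow> u \<in> S'"
  shows "joins_M2 w prec S v \<longleftrightarrow> joins_M2 w prec S' v"
  using assms(3,4)
proof (induction "rank v" arbitrary: v rule: less_induct)
  case less
  have "joins_M2 w prec S u \<longleftrightarrow> joins_M2 w prec S' u" if "u \<in> V" "(u, v) \<in> prec" for u
    using that less.prems prec_trans by (intro less.hyps rank_less) blast+
  then have "{u \<in> S. (u, v) \<in> prec \<and> joins_M2 w prec S u} =
      {u \<in> S'. (u, v) \<in> prec \<and> joins_M2 w prec S' u}"
    using assms(1,2) less.prems by blast
  then show ?case
    by (simp only: joins_M2_iff[OF assms(1), of v] joins_M2_iff[OF assms(2), of v])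
qed

section \<open>Independent sets and the charging argument\<close>

lemma wbar_nonneg: "u \<in> V \<Longrightarrow> v \<in> V \<Longrightarrow> 0 \<le> wbar w u v"
  using weight_range[of u v] weight_range[of v u] by (simp add: wbar_def)

lemma wbar_le_2: "u \<in> V \<Longrightarrow> v \<in> V \<Longrightarrow> wbar w u v \<le> 2"
  using weight_range[of u v] weight_range[of v u] by (simp add: wbar_def)

lemma independent_set_mono:
  assumes "independent_set w T" "T' \<subseteq> T" "T \<subseteq> V"
  shows "independent_set w T'"
  unfolding independent_set_def
proof
  fix v assume "v \<in> T'"
  have "(\<Sum>u\<in>T'. w u v) \<le> (\<Sum>u\<in>T. w u v)"
    using assms \<open>v \<in> T'\<close> weight_range finite_subset[OF assms(3) finite_nodes]
    by (intro sum_mono2) (blast+)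
  also have "\<dots> < 1"
    using assms \<open>v \<in> T'\<close> by (auto simp: independent_set_def)
  finally show "(\<Sum>u\<in>T'. w u v) < 1" .
qed

lemma OPT_attained:
  assumes "S \<subseteq> V"
  obtains T where "T \<subseteq> S" "independent_set w T" "OPT w S = card T"
proof -
  let ?A = "{T. T \<subseteq> S \<and> independent_set w T}"
  have "finite ?A" "{} \<in> ?A"
    using finite_subset[OF assms finite_nodes] by (auto simp: independent_set_def)
  then have "Max (card ` ?A) \<in> card ` ?A"
    by (intro Max_in) auto
  then show ?thesis
    using that by (auto simp: OPT_def)
qed

lemma card_le_OPT:
  assumes "S \<subseteq> V" "T \<subseteq> S" "independent_set w T"
  shows "card T \<le> OPT w S"
  unfolding OPT_def using assms finite_subset[OF assms(1) finite_nodes]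
  by (intro Max_ge) auto

text \<open>A rejected node of an independent set \<open>T\<close> is charged to \<open>M\<^sub>1\<close> with weight at least 1, and each
  node of \<open>M\<^sub>1\<close> pays at most \<open>r\<close>.\<close>

lemma OPT_le_M1:
  assumes "inductive_order V w prec r" "1 \<le> r" "S \<subseteq> V"
  shows "real (OPT w S) \<le> 2 * r * real (card (M1 w prec S))"
proof -
  obtain T where T: "T \<subseteq> S" "independent_set w T" "OPT w S = card T"
    using OPT_attained[OF assms(3)] .
  let ?M = "M1 w prec S"
  have fin: "finite S" "finite T" "finite ?M" "?M \<subseteq> V" "T \<subseteq> V"
    using finite_subset[OF assms(3) finite_nodes] T M1_eq[OF assms(3)] assms(3)
    by (auto intro: finite_subset)
  have "real (card (T - ?M)) = (\<Sum>v\<in>T - ?M. 1)"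
    by simp
  also have "\<dots> \<le> (\<Sum>v\<in>T - ?M. \<Sum>u\<in>{u \<in> ?M. (u, v) \<in> prec}. wbar w u v)"
    using T M1_eq[OF assms(3)] by (intro sum_mono) (auto simp: joins_M2_def)
  also have "\<dots> \<le> (\<Sum>v\<in>T. \<Sum>u\<in>{u \<in> ?M. (u, v) \<in> prec}. wbar w u v)"
    using fin wbar_nonneg by (intro sum_mono2 sum_nonneg) (auto simp: subset_iff)
  \<comment> \<open>After the sums are swapped, \<open>u\<close> pays only for later nodes of the
    independent set \<open>T\<close>, hence at most \<open>r\<close>.\<close>
  also have "\<dots> = (\<Sum>u\<in>?M. \<Sum>v\<in>{v \<in> T. (u, v) \<in> prec}. wbar w v u)"
    using fin by (subst sum.swap_restrict) (simp_all add: wbar_commute)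
  also have "\<dots> \<le> (\<Sum>u\<in>?M. r)"
    using assms(1) T fin by (intro sum_mono) (auto simp: inductive_order_def)
  also have "\<dots> = r * card ?M"
    by simp
  finally have "real (card (T - ?M)) \<le> r * card ?M" .
  moreover have "card T \<le> card (T - ?M) + card ?M"
    using fin by (metis Un_Diff_cancel2 card_Un_le card_mono finite_Un order_trans sup_ge1)
  \<comment> \<open>The nodes of \<open>T\<close> inside \<open>M1\<close> are paid for by
    \<open>1 \<le> r\<close>, which produces the factor 2.\<close>
  moreover have "1 * real (card ?M) \<le> r * card ?M"
    using assms(2) by (intro mult_right_mono) auto
  ultimately show ?thesis
    using T(3) by simp
qed

end

section \<open>The weight inside the candidate set\<close>

text \<open>A linear bound on [0, 2], the range of \<open>wbar\<close>, from the quadratic Taylor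
  lower bound for \<open>exp a\<close>. Its slope 3/8 is the origin of the rate 3 / (8 (1 +
  c)).\<close>

lemma exp_minus_le:
  fixes a :: real
  assumes "0 \<le> a" "a \<le> 2"
  shows "exp (- a) \<le> 1 - 3 * a / 8"
proof -
  have "0 \<le> (a * (2 - a)) * (3 * a / 16 + 1 / 4) + a / 8"
    using assms by (intro add_nonneg_nonneg mult_nonneg_nonneg) auto
  also have "\<dots> = (1 - 3 * a / 8) * (1 + a + a\<^sup>2 / 2) - 1"
    by (simp add: field_simps power2_eq_square power3_eq_cube)
  also have "\<dots> \<le> (1 - 3 * a / 8) * exp a - 1"
    using assms exp_lower_Taylor_quadratic[of a] by (intro diff_right_mono mult_left_mono) auto
  finally show ?thesis
    by (simp add: exp_minus field_simps)
qed

locale ordered_graph_sampling = graph_sampling V w c D + ordered_conflict_graph V w prec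
  for V :: "'a set" and w :: "'a \<Rightarrow> 'a \<Rightarrow> real" and c :: real and D :: "('a set \<times> 'a set) pmf"
    and prec :: "'a rel"
begin

section \<open>Expectations under the sampling law\<close>

abbreviation Ex :: "('a set \<Rightarrow> 'a set \<Rightarrow> real) \<Rightarrow> real" where
  "Ex f \<equiv> measure_pmf.expectation D (\<lambda>(I, S). f I S)"

abbreviation pI :: "'a \<Rightarrow> real" where
  "pI v \<equiv> measure_pmf.prob D {(I, S). v \<in> I}"

abbreviation pS :: "'a \<Rightarrow> real" where
  "pS v \<equiv> measure_pmf.prob D {(I, S). v \<in> S}"

abbreviation joins :: "'a set \<Rightarrow> 'a \<Rightarrow> bool" where
  "joins S v \<equiv> joins_M2 w prec S v"

lemma finite_support: "finite (set_pmf D)"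
proof (rule finite_subset)
  show "set_pmf D \<subseteq> Pow V \<times> Pow V"
    using sampled_subsets by auto
qed (simp add: finite_nodes)

lemma integrable_D [simp]: "integrable (measure_pmf D) (f :: _ \<Rightarrow> real)"
  by (rule integrable_measure_pmf_finite[OF finite_support])

lemma Ex_mono:
  assumes "\<And>I S. (I, S) \<in> set_pmf D \<Longrightarrow> I \<subseteq> V \<Longrightarrow> S \<subseteq> V \<Longrightarrow> f I S \<le> g I S"
  shows "Ex f \<le> Ex g"
  using assms sampled_subsets
  by (intro integral_mono_AE) (auto simp: AE_measure_pmf_iff)

lemma Ex_cong:
  assumes "\<And>I S. (I, S) \<in> set_pmf D \<Longrightarrow> I \<subseteq> V \<Longrightarrow> S \<subseteq> V \<Longrightarrow> f I S = g I S"
  shows "Ex f = Ex g"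
  by (intro antisym Ex_mono) (use assms in auto)

lemma Ex_add: "Ex (\<lambda>I S. f I S + g I S) = Ex f + Ex g"
  by (simp add: case_prod_unfold)

lemma Ex_diff: "Ex (\<lambda>I S. f I S - g I S) = Ex f - Ex g"
  by (simp add: case_prod_unfold)

lemma Ex_cmult: "Ex (\<lambda>I S. a * f I S) = a * Ex f"
  by (simp add: case_prod_unfold)

lemma Ex_sum: "Ex (\<lambda>I S. \<Sum>x\<in>A. f x I S) = (\<Sum>x\<in>A. Ex (f x))"
  by (simp add: case_prod_unfold)

lemma Ex_const [simp]: "Ex (\<lambda>I S. a) = a"
  by (simp add: case_prod_unfold)

lemma Ex_nonneg: "(\<And>I S. I \<subseteq> V \<Longrightarrow> S \<subseteq> V \<Longrightarrow> 0 \<le> f I S) \<Longrightarrow> 0 \<le> Ex f"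
  using Ex_mono[of "\<lambda>_ _. 0" f] by simp

lemma Ex_of_bool: "Ex (\<lambda>I S. of_bool (P I S)) = measure_pmf.prob D {(I, S). P I S}"
proof -
  have "(\<lambda>(I, S). of_bool (P I S)) = (indicator {(I, S). P I S} :: _ \<Rightarrow> real)"
    by (auto simp: fun_eq_iff)
  then show ?thesis
    by simp
qed

text \<open>\<open>g\<close> reads only coordinates away from \<open>v\<close>, and \<open>h\<close>
  only those at \<open>v\<close>. Since the two memberships of \<open>v\<close> may be correlated,
  \<open>h\<close> takes both at once.\<close>

lemma Ex_indep:
  fixes h :: "bool \<Rightarrow> bool \<Rightarrow> real"
  assumes v: "v \<in> V" and g: "\<And>S. S \<subseteq> V \<Longrightarrow> g S = g (S - {v})"
  shows "Ex (\<lambda>I S. g S * h (v \<in> I) (v \<in> S)) = Ex (\<lambda>I S. g S) * Ex (\<lambda>I S. h (v \<in> I) (v \<in> S))"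
proof -
  define X where "X = (\<lambda>v (I, S). (v \<in> (I :: 'a set), v \<in> (S :: 'a set)))"
  \<comment> \<open>\<open>g\<close> is evaluated on the sample with \<open>v\<close> removed, which
    its assumption allows.\<close>
  define g' where "g' = (\<lambda>f :: 'a \<Rightarrow> bool \<times> bool. g {u \<in> V - {v}. snd (f u)})"
  define h' where "h' = (\<lambda>f :: 'a \<Rightarrow> bool \<times> bool. h (fst (f v)) (snd (f v)))"
  let ?X1 = "\<lambda>x. restrict (\<lambda>u. X u x) (V - {v})" and ?X2 = "\<lambda>x. restrict (\<lambda>u. X u x) {v}"
  have "prob_space.indep_var (measure_pmf D) (PiM (V - {v}) (\<lambda>_. count_space UNIV)) ?X1
      (PiM {v} (\<lambda>_. count_space UNIV)) ?X2"
    using indep_nodes v unfolding X_def by (intro prob_space.indep_var_restrict[OF measure_pmf.prob_space_axioms]) auto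
  then have "prob_space.indep_var (measure_pmf D) borel (g' \<circ> ?X1) borel (h' \<circ> ?X2)"
    by (rule prob_space.indep_var_compose[OF measure_pmf.prob_space_axioms]) (use finite_nodes in \<open>auto simp: count_space_PiM_finite\<close>)
  then have prod: "measure_pmf.expectation D (\<lambda>x. (g' \<circ> ?X1) x * (h' \<circ> ?X2) x) =
      measure_pmf.expectation D (g' \<circ> ?X1) * measure_pmf.expectation D (h' \<circ> ?X2)"
    by (rule prob_space.indep_var_lebesgue_integral[OF measure_pmf.prob_space_axioms]) auto
  have g': "(g' \<circ> ?X1) (I, S) = g S" if "S \<subseteq> V" for I S
  proof -
    have "{u \<in> V - {v}. snd (?X1 (I, S) u)} = S - {v}"
      using that by (auto simp: X_def)
    then show ?thesis
      unfolding g'_def o_def using g[OF that] by simp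
  qed
  have h': "(h' \<circ> ?X2) (I, S) = h (v \<in> I) (v \<in> S)" for I S
    by (simp add: h'_def X_def)
  have cong: "measure_pmf.expectation D F = Ex f"
    if "\<And>I S. S \<subseteq> V \<Longrightarrow> F (I, S) = f I S" for F f
    using Ex_cong[of "\<lambda>I S. F (I, S)" f] that by simp
  have "measure_pmf.expectation D (\<lambda>x. (g' \<circ> ?X1) x * (h' \<circ> ?X2) x) =
      Ex (\<lambda>I S. g S * h (v \<in> I) (v \<in> S))"
    by (intro cong) (simp only: g' h')
  moreover have "measure_pmf.expectation D (g' \<circ> ?X1) = Ex (\<lambda>I S. g S)"
    by (intro cong) (simp only: g')
  moreover have "measure_pmf.expectation D (h' \<circ> ?X2) = Ex (\<lambda>I S. h (v \<in> I) (v \<in> S))"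
    by (intro cong) (simp only: h')
  ultimately show ?thesis
    using prod by (simp only:)
qed

text \<open>Every node occurs in one of the two sets, so its marginals sum to at least 1, while each
  is at most \<open>c\<close> times the other.\<close>

lemma pS_ge: "v \<in> V \<Longrightarrow> 1 / (1 + c) \<le> pS v" and pI_ge: "v \<in> V \<Longrightarrow> 1 / (1 + c) \<le> pI v"
proof -
  assume v: "v \<in> V"
  have "1 = Ex (\<lambda>I S. 1)"
    by simp
  also have "\<dots> \<le> Ex (\<lambda>I S. of_bool (v \<in> I) + of_bool (v \<in> S) + of_bool (v \<notin> S \<and> v \<notin> I))"
    by (intro Ex_mono) auto
  also have "\<dots> = pI v + pS v + measure_pmf.prob D {(I, S). v \<notin> S \<and> v \<notin> I}"
    by (simp only: Ex_add Ex_of_bool)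
  finally have sum: "1 \<le> pI v + pS v"
    using never_absent[OF v] by simp
  then show "1 / (1 + c) \<le> pS v"
    using ratio_upper[OF v] c_ge_1 by (simp add: field_simps)
  have "pS v \<le> c * pI v"
    using ratio_lower[OF v] c_ge_1 by (simp add: field_simps)
  then show "1 / (1 + c) \<le> pI v"
    using sum c_ge_1 by (simp add: field_simps)
qed

text \<open>Supplies the invariance required by \<open>Ex_indep\<close>, notably for
  \<open>u = v\<close>.\<close>

lemma joins_remove:
  assumes "S \<subseteq> V" "v \<in> V" "(u, v) \<notin> prec"
  shows "joins (S - {u}) v \<longleftrightarrow> joins S v"
  by (rule joins_M2_cong) (use assms in auto)

section \<open>The exponential moment along the order\<close>

lemma obtain_maximum:
  assumes "A \<subseteq> V" "A \<noteq> {}"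
  obtains u where "u \<in> A" "\<And>x. x \<in> A \<Longrightarrow> (u, x) \<notin> prec"
proof -
  have "finite A"
    using assms finite_nodes finite_subset by blast
  then obtain u where u: "u \<in> A" "Max (rank ` A) = rank u"
    using assms by (metis Max_in finite_imageI image_is_empty imageE)
  then have "rank x \<le> rank u" if "x \<in> A" for x
    using that \<open>finite A\<close> by (metis Max_ge finite_imageI imageI)
  then show ?thesis
    using that u assms rank_less by (metis leD subsetD)
qed

text \<open>Every node that qualifies enters the sample with probability at least \<open>1 / (1 + c)\<close>,
  independently of the past. So the total weight of the qualifying nodes, scaled by
  \<open>3 / (8 (1 + c))\<close>, minus the weight of the sampled ones is the logarithm of a supermartingale.\<close>

lemma exp_moment_le_1:
  assumes "A \<subseteq> V" "\<And>x y. x \<in> A \<Longrightarrow> y \<in> V \<Longrightarrow> (y, x) \<in> prec \<Longrightarrow> y \<in> A"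
    and a: "\<And>u. u \<in> A \<Longrightarrow> 0 \<le> a u \<and> a u \<le> 2"
  shows "Ex (\<lambda>I S. exp (\<Sum>u\<in>{u \<in> A. joins S u}. 3 / (8 * (1 + c)) * a u - of_bool (u \<in> S) * a u)) \<le> 1"
  using finite_subset[OF assms(1) finite_nodes] assms
proof (induction rule: finite_psubset_induct)
  case (psubset A)
  define f where "f = (\<lambda>S u. 3 / (8 * (1 + c)) * a u - of_bool (u \<in> S) * a u)"
  define F where "F = (\<lambda>A S. exp (\<Sum>u\<in>{u \<in> A. joins S u}. f S u))"
  show ?case
  proof (cases "A = {}")
    case False
    then obtain u where u: "u \<in> A" and max: "\<And>x. x \<in> A \<Longrightarrow> (u, x) \<notin> prec"
      using obtain_maximum psubset.prems(1) by metis
    define B where "B = A - {u}"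
    define h where "h = (\<lambda>(i :: bool) s. exp (3 / (8 * (1 + c)) * a u - of_bool s * a u))"
    have uV: "u \<in> V" and B: "B \<subseteq> V" "A = insert u B" "u \<notin> B" "finite B"
      using u psubset by (auto simp: B_def)
    have IH: "Ex (\<lambda>I. F B) \<le> 1"
      unfolding F_def f_def
      by (rule psubset.IH) (use u psubset.prems max in \<open>auto simp: B_def\<close>)
    \<comment> \<open>Being last in \<open>A\<close>, the node \<open>u\<close> influences no
      qualification in \<open>B\<close>, so the factor for \<open>B\<close> is independent of
      whether \<open>u\<close> is sampled.\<close>
    have F_remove: "F B S = F B (S - {u})" if "S \<subseteq> V" for S
      unfolding F_def
    proof (intro arg_cong[where f = exp] sum.cong)
      show "{x \<in> B. joins S x} = {x \<in> B. joins (S - {u}) x}"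
        using joins_remove[OF that] max B by auto
    qed (use B in \<open>auto simp: f_def\<close>)
    \<comment> \<open>Sampling \<open>u\<close> shrinks the factor by \<open>exp (- a u)\<close>
      with probability at least 1 / (1 + c); this compensates the deterministic growth
      \<open>exp ?x\<close>.\<close>
    have h_le: "Ex (\<lambda>I S. h (u \<in> I) (u \<in> S)) \<le> 1"
    proof -
      let ?x = "3 / (8 * (1 + c)) * a u"
      have au: "0 \<le> a u" "a u \<le> 2"
        using u psubset.prems by auto
      have "Ex (\<lambda>I S. h (u \<in> I) (u \<in> S)) =
          Ex (\<lambda>I S. exp ?x * (1 - (1 - exp (- a u)) * of_bool (u \<in> S)))"
        by (intro Ex_cong) (auto simp: h_def exp_diff exp_minus field_simps)
      also have "\<dots> = exp ?x * (1 - (1 - exp (- a u)) * pS u)"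
        by (simp only: Ex_cmult Ex_diff Ex_of_bool Ex_const)
      also have "\<dots> \<le> exp ?x * (1 - (3 * a u / 8) * (1 / (1 + c)))"
        using exp_minus_le[OF au] pS_ge[OF uV] au c_ge_1
        by (intro mult_left_mono diff_left_mono mult_mono) auto
      also have "\<dots> \<le> exp ?x * exp (- ?x)"
        using exp_ge_add_one_self[of "- ?x"] by (intro mult_left_mono) (auto simp: field_simps)
      also have "\<dots> = 1"
        by (simp add: exp_minus)
      finally show ?thesis .
    qed
    \<comment> \<open>The factor for \<open>u\<close> appears only if \<open>u\<close> qualifies,
      and that event too is unaffected by sampling \<open>u\<close>.\<close>
    have "Ex (\<lambda>I. F A) = Ex (\<lambda>I S. F B S * of_bool (joins S u) * h (u \<in> I) (u \<in> S)
        + F B S * of_bool (\<not> joins S u))"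
    proof (intro Ex_cong)
      fix I S :: "'a set"
      have "{x \<in> A. joins S x} = (if joins S u then insert u {x \<in> B. joins S x} else {x \<in> B. joins S x})"
        using B by auto
      then show "F A S = F B S * of_bool (joins S u) * h (u \<in> I) (u \<in> S) + F B S * of_bool (\<not> joins S u)"
        using B by (simp add: F_def h_def f_def exp_add)
    qed
    also have "\<dots> = Ex (\<lambda>I S. F B S * of_bool (joins S u)) * Ex (\<lambda>I S. h (u \<in> I) (u \<in> S))
        + Ex (\<lambda>I S. F B S * of_bool (\<not> joins S u))"
      unfolding Ex_add
      by (subst Ex_indep) (use uV F_remove joins_remove[OF _ uV prec_irrefl] in auto)
    also have "\<dots> \<le> Ex (\<lambda>I S. F B S * of_bool (joins S u)) * 1
        + Ex (\<lambda>I S. F B S * of_bool (\<not> joins S u))"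
      by (intro add_right_mono mult_left_mono h_le Ex_nonneg) (auto simp: F_def)
    also have "\<dots> = Ex (\<lambda>I S. F B S * of_bool (joins S u) + F B S * of_bool (\<not> joins S u))"
      by (simp only: Ex_add mult_1_right)
    also have "\<dots> = Ex (\<lambda>I. F B)"
      by (intro Ex_cong) auto
    finally show ?thesis
      using IH unfolding F_def f_def by linarith
  qed simp
qed

text \<open>Unlike the sum tested in \<open>joins_M2\<close>, this also counts qualifying
  predecessors outside the sample, so it bounds the weight from earlier nodes of
  \<open>M2\<close>.\<close>

definition mass :: "'a set \<Rightarrow> 'a \<Rightarrow> real" where
  "mass S v = (\<Sum>u\<in>{u \<in> V. (u, v) \<in> prec \<and> joins S u}. wbar w u v)"

definition M2 :: "'a set \<Rightarrow> 'a set \<Rightarrow> 'a set" where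
  "M2 I S = {v \<in> I. joins S v}"

lemma mass_nonneg: "v \<in> V \<Longrightarrow> 0 \<le> mass S v"
  unfolding mass_def by (intro sum_nonneg) (auto intro: wbar_nonneg)

lemma mass_remove:
  assumes "S \<subseteq> V" "v \<in> V"
  shows "mass (S - {v}) v = mass S v"
proof -
  have "joins (S - {v}) u \<longleftrightarrow> joins S u" if "u \<in> V" "(u, v) \<in> prec" for u
    using joins_remove[OF assms(1) that(1)] prec_asym[OF that(2)] .
  then show ?thesis
    unfolding mass_def by (intro sum.cong) auto
qed

text \<open>A qualifying node has sampled load below 1, so a large mass makes the quantity bounded
  in \<open>exp_moment_le_1\<close> large. The expected mass beyond a free threshold
  \<open>K\<close> is therefore exponentially small.\<close>

lemma mass_joins_le:
  assumes v: "v \<in> V"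
  shows "Ex (\<lambda>I S. mass S v * of_bool (joins S v)) \<le>
    K * Ex (\<lambda>I S. of_bool (joins S v)) + 8 * (1 + c) / 3 * exp (- (3 * K / (8 * (1 + c))))"
proof -
  define l where "l = 3 / (8 * (1 + c))"
  have l: "0 < l" "1 / l = 8 * (1 + c) / 3" "l * K = 3 * K / (8 * (1 + c))"
    using c_ge_1 by (auto simp: l_def)
  let ?A = "{u \<in> V. (u, v) \<in> prec}"
  define E where "E = (\<lambda>S. exp (\<Sum>u\<in>{u \<in> ?A. joins S u}. l * wbar w u v - of_bool (u \<in> S) * wbar w u v))"
  have E_le: "Ex (\<lambda>I. E) \<le> 1"
    unfolding E_def l_def
    by (rule exp_moment_le_1) (use v prec_trans wbar_nonneg wbar_le_2 in blast)+
  have "Ex (\<lambda>I S. mass S v * of_bool (joins S v)) \<le>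
      Ex (\<lambda>I S. K * of_bool (joins S v) + 1 / l * exp (- (l * K)) * E S)"
  proof (rule Ex_mono)
    fix I S assume S: "S \<subseteq> V"
    let ?load = "\<Sum>u\<in>{u \<in> S. (u, v) \<in> prec \<and> joins S u}. wbar w u v"
    have "(\<Sum>u\<in>{u \<in> ?A. joins S u}. of_bool (u \<in> S) * wbar w u v) =
        (\<Sum>u\<in>{u \<in> S. (u, v) \<in> prec \<and> joins S u}. wbar w u v)"
      using S finite_nodes by (intro sum.mono_neutral_cong_right) auto
    moreover have "{u \<in> ?A. joins S u} = {u \<in> V. (u, v) \<in> prec \<and> joins S u}"
      by auto
    ultimately have E: "E S = exp (l * mass S v - ?load)"
      by (simp add: E_def mass_def sum_subtractf sum_distrib_left)
    show "mass S v * of_bool (joins S v) \<le> K * of_bool (joins S v) + 1 / l * exp (- (l * K)) * E S"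
    proof (cases "joins S v")
      case True
      then have "?load < 1"
        using joins_M2_iff[OF S] by blast
      \<comment> \<open>The excess over \<open>K\<close> is dominated by
        \<open>x \<le> exp (x - 1)\<close>; the 1 in the exponent is then traded for the smaller
        load.\<close>
      have "l * (mass S v - K) \<le> exp (l * (mass S v - K) - 1)"
        using exp_ge_add_one_self[of "l * (mass S v - K) - 1"] by simp
      also have "\<dots> \<le> exp (l * (mass S v - K) - ?load)"
        using \<open>?load < 1\<close> by simp
      also have "\<dots> = exp (- (l * K)) * E S"
        unfolding E by (simp add: exp_add[symmetric] algebra_simps)
      finally show ?thesis
        using True l(1) by (simp add: field_simps)
    next
      case False
      then show ?thesis
        using l by (simp add: E_def)
    qed
  qed
  also have "\<dots> = K * Ex (\<lambda>I S. of_bool (joins S v)) + 1 / l * exp (- (l * K)) * Ex (\<lambda>I. E)"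
    by (simp only: Ex_add Ex_cmult)
  also have "\<dots> \<le> K * Ex (\<lambda>I S. of_bool (joins S v)) + 1 / l * exp (- (l * K)) * 1"
    using E_le l(1) by (intro add_left_mono mult_left_mono) auto
  finally show ?thesis
    by (simp only: l mult_1_right)
qed

section \<open>Expected size and weight of the candidate set\<close>

lemma M2_sum:
  assumes "I \<subseteq> V"
  shows "(\<Sum>v\<in>M2 I S. f v) = (\<Sum>v\<in>V. (f v * of_bool (joins S v)) * (of_bool (v \<in> I) :: real))"
  using assms finite_nodes by (intro sum.mono_neutral_cong_left) (auto simp: M2_def)

text \<open>Arrival of \<open>v\<close> is an event at the coordinate of \<open>v\<close>, which
  affects neither its qualification nor \<open>f S v\<close>; so the marginal factors out.\<close>

lemma Ex_M2_sum:
  assumes "\<And>S v. S \<subseteq> V \<Longrightarrow> v \<in> V \<Longrightarrow> f S v = f (S - {v}) v"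
  shows "Ex (\<lambda>I S. \<Sum>v\<in>M2 I S. f S v) = (\<Sum>v\<in>V. pI v * Ex (\<lambda>I S. f S v * of_bool (joins S v)))"
proof -
  have "Ex (\<lambda>I S. \<Sum>v\<in>M2 I S. f S v) =
      Ex (\<lambda>I S. \<Sum>v\<in>V. (f S v * of_bool (joins S v)) * of_bool (v \<in> I))"
    by (intro Ex_cong M2_sum)
  also have "\<dots> = (\<Sum>v\<in>V. Ex (\<lambda>I S. (f S v * of_bool (joins S v)) * of_bool (v \<in> I)))"
    by (rule Ex_sum)
  also have "\<dots> = (\<Sum>v\<in>V. pI v * Ex (\<lambda>I S. f S v * of_bool (joins S v)))"
  proof (rule sum.cong)
    fix v assume v: "v \<in> V"
    have "Ex (\<lambda>I S. (f S v * of_bool (joins S v)) * of_bool (v \<in> I)) =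
        Ex (\<lambda>I S. f S v * of_bool (joins S v)) * Ex (\<lambda>I S. of_bool (v \<in> I))"
      by (rule Ex_indep[OF v, where h = "\<lambda>i s. of_bool i"])
        (use assms[OF _ v] joins_remove[OF _ v prec_irrefl] in auto)
    then show "Ex (\<lambda>I S. (f S v * of_bool (joins S v)) * of_bool (v \<in> I)) =
        pI v * Ex (\<lambda>I S. f S v * of_bool (joins S v))"
      by (simp add: Ex_of_bool)
  qed simp
  finally show ?thesis .
qed

lemma Ex_card_M2: "Ex (\<lambda>I S. real (card (M2 I S))) = (\<Sum>v\<in>V. pI v * Ex (\<lambda>I S. of_bool (joins S v)))"
  using Ex_M2_sum[of "\<lambda>_ _. 1"] by simp

text \<open>The qualification probabilities are those of \<open>Ex_card_M2\<close>; only the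
  marginals differ, which makes \<open>M1\<close> and \<open>M2\<close> comparable.\<close>

lemma Ex_card_M1: "Ex (\<lambda>I S. real (card (M1 w prec S))) = (\<Sum>v\<in>V. pS v * Ex (\<lambda>I S. of_bool (joins S v)))"
proof -
  have "Ex (\<lambda>I S. real (card (M1 w prec S))) = Ex (\<lambda>I S. \<Sum>v\<in>V. of_bool (joins S v) * of_bool (v \<in> S))"
  proof (rule Ex_cong)
    fix I S assume "S \<subseteq> V"
    then have "(\<Sum>v\<in>M1 w prec S. 1) = (\<Sum>v\<in>V. of_bool (joins S v) * (of_bool (v \<in> S) :: real))"
      using finite_nodes by (intro sum.mono_neutral_cong_left) (auto simp: M1_eq)
    then show "real (card (M1 w prec S)) = (\<Sum>v\<in>V. of_bool (joins S v) * of_bool (v \<in> S))"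
      by simp
  qed
  also have "\<dots> = (\<Sum>v\<in>V. Ex (\<lambda>I S. of_bool (joins S v) * of_bool (v \<in> S)))"
    by (rule Ex_sum)
  also have "\<dots> = (\<Sum>v\<in>V. pS v * Ex (\<lambda>I S. of_bool (joins S v)))"
  proof (rule sum.cong)
    fix v assume v: "v \<in> V"
    have "Ex (\<lambda>I S. of_bool (joins S v) * of_bool (v \<in> S)) =
        Ex (\<lambda>I S. of_bool (joins S v)) * Ex (\<lambda>I S. of_bool (v \<in> S))"
      by (rule Ex_indep[OF v, where h = "\<lambda>i s. of_bool s"])
        (use joins_remove[OF _ v prec_irrefl] in auto)
    then show "Ex (\<lambda>I S. of_bool (joins S v) * of_bool (v \<in> S)) = pS v * Ex (\<lambda>I S. of_bool (joins S v))"
      by (simp add: Ex_of_bool)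
  qed simp
  finally show ?thesis .
qed

text \<open>The first node in the order has no predecessors and always qualifies. This lower bound
  later absorbs additive errors.\<close>

lemma Ex_card_M2_ge:
  assumes "V \<noteq> {}"
  shows "1 / (1 + c) \<le> Ex (\<lambda>I S. real (card (M2 I S)))"
proof -
  obtain v where v: "v \<in> V" "\<And>u. u \<in> V \<Longrightarrow> rank v \<le> rank u"
    using assms finite_nodes ex_min_if_finite[of "rank ` V"] by (force simp: not_less)
  have "joins S v" if "S \<subseteq> V" for S
  proof -
    have "{u \<in> S. (u, v) \<in> prec \<and> joins S u} = {}"
      using v rank_less[of _ v] that by (force simp: not_less[symmetric])
    then show ?thesis
      using joins_M2_iff[OF that, of v] by (simp only: sum.empty)
  qed
  then have "Ex (\<lambda>I S. of_bool (joins S v)) = Ex (\<lambda>I S. 1)"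
    by (intro Ex_cong) auto
  then have "1 / (1 + c) \<le> pI v * Ex (\<lambda>I S. of_bool (joins S v))"
    using pI_ge v by simp
  also have "\<dots> \<le> (\<Sum>v\<in>V. pI v * Ex (\<lambda>I S. of_bool (joins S v)))"
    using v finite_nodes by (intro member_le_sum) (auto intro!: mult_nonneg_nonneg Ex_nonneg)
  finally show ?thesis
    by (simp add: Ex_card_M2)
qed

text \<open>The threshold \<open>K\<close> is chosen as \<open>L * ln ?n\<close>, so that the tail
  is \<open>L / ?n\<close> per node and at most \<open>L\<close> in total.\<close>

lemma Ex_mass_M2_le:
  assumes "V \<noteq> {}"
  shows "Ex (\<lambda>I S. \<Sum>v\<in>M2 I S. mass S v) \<le>
    8 * (1 + c) / 3 * (ln (card V) + 1 + c) * Ex (\<lambda>I S. real (card (M2 I S)))"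
proof -
  let ?n = "real (card V)" and ?m = "Ex (\<lambda>I S. real (card (M2 I S)))"
  define L where "L = 8 * (1 + c) / 3"
  have L: "0 < L" using c_ge_1 by (simp add: L_def)
  have n: "0 < ?n"
    using assms finite_nodes by (simp add: card_gt_0_iff)
  have "Ex (\<lambda>I S. \<Sum>v\<in>M2 I S. mass S v) = (\<Sum>v\<in>V. pI v * Ex (\<lambda>I S. mass S v * of_bool (joins S v)))"
    by (rule Ex_M2_sum) (simp add: mass_remove)
  also have "\<dots> \<le> (\<Sum>v\<in>V. pI v * (L * ln ?n * Ex (\<lambda>I S. of_bool (joins S v)) + L / ?n))"
  proof (intro sum_mono mult_left_mono)
    fix v assume "v \<in> V"
    have "3 * (L * ln ?n) / (8 * (1 + c)) = ln ?n"
      using c_ge_1 by (simp add: L_def)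
    then have "exp (- (3 * (L * ln ?n) / (8 * (1 + c)))) = 1 / ?n"
      using n by (simp add: exp_minus inverse_eq_divide)
    then show "Ex (\<lambda>I S. mass S v * of_bool (joins S v)) \<le> L * ln ?n * Ex (\<lambda>I S. of_bool (joins S v)) + L / ?n"
      using mass_joins_le[OF \<open>v \<in> V\<close>, of "L * ln ?n"] unfolding L_def[symmetric] by simp
  qed simp
  also have "\<dots> = L * ln ?n * ?m + (\<Sum>v\<in>V. pI v * (L / ?n))"
    by (simp add: Ex_card_M2 sum.distrib algebra_simps sum_distrib_left)
  also have "\<dots> \<le> L * ln ?n * ?m + (\<Sum>v\<in>V. 1 * (L / ?n))"
    using L by (intro add_left_mono sum_mono mult_right_mono) auto
  also have "\<dots> = L * ln ?n * ?m + L"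
    using n by simp
  \<comment> \<open>The additive \<open>L\<close> is absorbed because \<open>(1 + c) * ?m\<close> is
    at least 1.\<close>
  also have "\<dots> \<le> L * ln ?n * ?m + L * ((1 + c) * ?m)"
    using mult_left_mono[of 1 "(1 + c) * ?m" L] Ex_card_M2_ge[OF assms] c_ge_1 L
    by (simp add: field_simps)
  also have "\<dots> = L * (ln ?n + 1 + c) * ?m"
    by algebra
  finally show ?thesis
    unfolding L_def .
qed

text \<open>Each pair is charged to its later node and is seen from both ends, hence the factor
  2.\<close>

lemma M2_pairs_le:
  assumes "I \<subseteq> V"
  shows "(\<Sum>v\<in>M2 I S. \<Sum>u\<in>M2 I S - {v}. wbar w u v) \<le> 2 * (\<Sum>v\<in>M2 I S. mass S v)"
proof -
  let ?M = "M2 I S"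
  have "?M \<subseteq> V"
    using assms by (auto simp: M2_def)
  then have M: "finite ?M" "?M \<subseteq> V"
    using finite_subset[OF _ finite_nodes] by auto
  have "(\<Sum>v\<in>?M. \<Sum>u\<in>?M - {v}. wbar w u v) =
      (\<Sum>v\<in>?M. (\<Sum>u\<in>{u \<in> ?M. (u, v) \<in> prec}. wbar w u v) + (\<Sum>u\<in>{u \<in> ?M. (v, u) \<in> prec}. wbar w u v))"
  proof (intro sum.cong refl)
    fix v assume "v \<in> ?M"
    then have "?M - {v} = {u \<in> ?M. (u, v) \<in> prec} \<union> {u \<in> ?M. (v, u) \<in> prec}"
      using M prec_total by auto
    then show "(\<Sum>u\<in>?M - {v}. wbar w u v) =
        (\<Sum>u\<in>{u \<in> ?M. (u, v) \<in> prec}. wbar w u v) + (\<Sum>u\<in>{u \<in> ?M. (v, u) \<in> prec}. wbar w u v)"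
      using M by (subst sum.union_disjoint[symmetric]) (auto dest: prec_asym)
  qed
  also have "\<dots> = (\<Sum>v\<in>?M. \<Sum>u\<in>{u \<in> ?M. (u, v) \<in> prec}. wbar w u v)
      + (\<Sum>v\<in>?M. \<Sum>u\<in>{u \<in> ?M. (v, u) \<in> prec}. wbar w u v)"
    by (rule sum.distrib)
  also have "(\<Sum>v\<in>?M. \<Sum>u\<in>{u \<in> ?M. (v, u) \<in> prec}. wbar w u v) =
      (\<Sum>v\<in>?M. \<Sum>u\<in>{u \<in> ?M. (u, v) \<in> prec}. wbar w u v)"
    using M(1) by (subst sum.swap_restrict) (simp_all add: wbar_commute)
  finally have "(\<Sum>v\<in>?M. \<Sum>u\<in>?M - {v}. wbar w u v) =
      2 * (\<Sum>v\<in>?M. \<Sum>u\<in>{u \<in> ?M. (u, v) \<in> prec}. wbar w u v)"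
    by simp
  also have "\<dots> \<le> 2 * (\<Sum>v\<in>?M. mass S v)"
    unfolding mass_def using M assms finite_nodes
    by (intro mult_left_mono sum_mono sum_mono2) (auto simp: M2_def intro!: wbar_nonneg)
  finally show ?thesis .
qed

end

section \<open>Coin flips and survivors\<close>

lemma fst_fold_online_step:
  "fst (fold (online_step w prec c S coin) xs (A, B)) =
    A \<union> {u \<in> set xs. joins_M2 w prec S u \<and> coin u}"
  by (induction xs arbitrary: A B) (auto simp: online_step_def)

lemma snd_fold_online_step_mono:
  "B \<subseteq> snd (fold (online_step w prec c S coin) xs (A, B))"
proof (induction xs arbitrary: A B)
  case (Cons x xs)
  obtain A' B' where step: "online_step w prec c S coin x (A, B) = (A', B')" by fastforce
  then have "B \<subseteq> B'" by (auto simp: online_step_def split: if_splits)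
  then show ?case using Cons.IH[of B' A'] step by auto
qed simp

lemma snd_fold_online_step_subset:
  "snd (fold (online_step w prec c S coin) xs (A, B)) \<subseteq> B \<union> set xs"
proof (induction xs arbitrary: A B)
  case (Cons x xs)
  obtain A' B' where step: "online_step w prec c S coin x (A, B) = (A', B')" by fastforce
  then have "B' \<subseteq> insert x B" by (auto simp: online_step_def split: if_splits)
  then show ?case using Cons.IH[of A' B'] step by auto
qed simp

text \<open>Conflicting candidates are required to show tails whether they arrive before or after
  \<open>v\<close>, so the criterion does not depend on the arrival order.\<close>

lemma in_M4I:
  assumes "v \<in> set xs" "distinct xs" "joins_M2 w prec S v" "coin v"
    and "\<And>u. u \<in> set xs \<Longrightarrow> u \<noteq> v \<Longrightarrow> joins_M2 w prec S u \<Longrightarrow>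
      1 / (4 * exp 1 * log 2 (n_tilde c S)) \<le> wbar w u v \<Longrightarrow> \<not> coin u"
  shows "v \<in> M4 w prec c S coin xs"
proof -
  obtain ys zs where xs: "xs = ys @ v # zs"
    using split_list[OF assms(1)] by blast
  let ?f = "online_step w prec c S coin"
  obtain A B where AB: "fold ?f ys ({}, {}) = (A, B)" by fastforce
  then have "A = {u \<in> set ys. joins_M2 w prec S u \<and> coin u}"
    using fst_fold_online_step[of w prec c S coin ys "{}" "{}"] by simp
  then have "?f v (A, B) = (insert v A, insert v B)"
    using assms xs by (auto simp: online_step_def)
  then have "M4 w prec c S coin xs = snd (fold ?f zs (insert v A, insert v B))"
    by (simp add: M4_def xs AB)
  then show ?thesis
    using snd_fold_online_step_mono by fastforce
qed

section \<open>Survival under independent coins\<close>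

context ordered_graph_sampling
begin

definition conflicts :: "'a set \<Rightarrow> 'a set \<Rightarrow> 'a \<Rightarrow> 'a set" where
  "conflicts I S v = {u \<in> M2 I S - {v}. 1 / (4 * exp 1 * log 2 (n_tilde c S)) \<le> wbar w u v}"

lemma finite_M2: "I \<subseteq> V \<Longrightarrow> finite (M2 I S)"
  by (rule finite_subset[OF _ finite_nodes]) (auto simp: M2_def)

lemma finite_coins: "finite (set_pmf (Pi_pmf V False (\<lambda>_. bernoulli_pmf q)))"
  using finite_nodes by (simp add: set_Pi_pmf finite_PiE_dflt)

lemma prob_coins:
  assumes "0 \<le> q" "q \<le> 1" "v \<in> V" "N \<subseteq> V - {v}"
  shows "measure_pmf.prob (Pi_pmf V False (\<lambda>_. bernoulli_pmf q)) {coin. coin v \<and> (\<forall>u\<in>N. \<not> coin u)} =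
    q * (1 - q) ^ card N"
proof -
  \<comment> \<open>Writes the event as a product set with one constraint per coin.\<close>
  define B where "B = (\<lambda>x. if x = v then {True} else if x \<in> N then {False} else UNIV)"
  have N: "finite N" "v \<notin> N"
    using assms finite_nodes finite_subset by auto
  have "{coin. coin v \<and> (\<forall>u\<in>N. \<not> coin u)} = Pi V B"
    using assms(3,4) by (fastforce simp: B_def Pi_def split: if_splits)
  then have "measure_pmf.prob (Pi_pmf V False (\<lambda>_. bernoulli_pmf q)) {coin. coin v \<and> (\<forall>u\<in>N. \<not> coin u)} =
      (\<Prod>x\<in>V. measure_pmf.prob (bernoulli_pmf q) (B x))"
    using finite_nodes by (simp add: measure_Pi_pmf_Pi)
  also have "\<dots> = (\<Prod>x\<in>insert v N. measure_pmf.prob (bernoulli_pmf q) (B x))"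
    using assms(3,4) finite_nodes by (intro prod.mono_neutral_right) (auto simp: B_def)
  also have "\<dots> = q * (\<Prod>x\<in>N. measure_pmf.prob (bernoulli_pmf q) (B x))"
    using N assms(1,2) by (simp add: B_def measure_pmf_single)
  also have "(\<Prod>x\<in>N. measure_pmf.prob (bernoulli_pmf q) (B x)) = (\<Prod>x\<in>N. 1 - q)"
    using N assms(1,2) by (intro prod.cong) (auto simp: B_def measure_pmf_single)
  finally show ?thesis
    by simp
qed

text \<open>The events \<open>?G v\<close> constrain coins only and never mention the order, so the
  bound holds even against an adversary who sees the coins.\<close>

lemma expected_card_M4_ge:
  assumes I: "I \<subseteq> V" and q: "0 \<le> q" "q \<le> 1"
    and arr: "\<And>coin. distinct (arr coin) \<and> set (arr coin) = I"
  shows "(\<Sum>v\<in>M2 I S. q * (1 - q) ^ card (conflicts I S v)) \<le>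
    measure_pmf.expectation (Pi_pmf V False (\<lambda>_. bernoulli_pmf q))
      (\<lambda>coin. real (card (M4 w prec c S coin (arr coin))))"
proof -
  let ?P = "Pi_pmf V False (\<lambda>_. bernoulli_pmf q)"
  let ?G = "\<lambda>v. {coin. coin v \<and> (\<forall>u\<in>conflicts I S v. \<not> coin u)}"
  have int: "integrable (measure_pmf ?P) (f :: _ \<Rightarrow> real)" for f
    by (rule integrable_measure_pmf_finite[OF finite_coins])
  have "(\<Sum>v\<in>M2 I S. q * (1 - q) ^ card (conflicts I S v)) = (\<Sum>v\<in>M2 I S. measure_pmf.prob ?P (?G v))"
    using I q by (intro sum.cong prob_coins[symmetric]) (auto simp: M2_def conflicts_def)
  also have "\<dots> = measure_pmf.expectation ?P (\<lambda>coin. \<Sum>v\<in>M2 I S. indicator (?G v) coin)"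
    by (subst Bochner_Integration.integral_sum) (simp_all add: int)
  also have "\<dots> \<le> measure_pmf.expectation ?P (\<lambda>coin. real (card (M4 w prec c S coin (arr coin))))"
  proof (rule integral_mono[OF int int])
    fix coin
    have "{v \<in> M2 I S. coin \<in> ?G v} \<subseteq> M4 w prec c S coin (arr coin)"
      using arr[of coin] by (auto intro!: in_M4I simp: M2_def conflicts_def)
    moreover have "finite (M4 w prec c S coin (arr coin))"
      using snd_fold_online_step_subset[of w prec c S coin "arr coin" "{}" "{}"]
      by (auto simp: M4_def intro: finite_subset)
    ultimately have "card {v \<in> M2 I S. coin \<in> ?G v} \<le> card (M4 w prec c S coin (arr coin))"
      by (rule card_mono[rotated])
    moreover have "(\<Sum>v\<in>M2 I S. indicator (?G v) coin) = real (card {v \<in> M2 I S. coin \<in> ?G v})"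
      using finite_M2[OF I] by (simp add: indicator_def of_bool_def[symmetric] sum_of_bool_eq Int_def)
    ultimately show "(\<Sum>v\<in>M2 I S. indicator (?G v) coin) \<le> real (card (M4 w prec c S coin (arr coin)))"
      by linarith
  qed
  finally show ?thesis .
qed

lemma expected_output_ge:
  assumes arr: "arrival_order D arr" and q: "\<And>I S. (I, S) \<in> set_pmf D \<Longrightarrow> 0 \<le> q S \<and> q S \<le> 1"
  shows "Ex (\<lambda>I S. \<Sum>v\<in>M2 I S. q S * (1 - q S) ^ card (conflicts I S v)) \<le>
    expected_output V w prec c D arr q"
proof -
  let ?E = "\<lambda>I S. measure_pmf.expectation (Pi_pmf V False (\<lambda>_. bernoulli_pmf (q S)))
      (\<lambda>coin. real (card (M4 w prec c S coin (arr I S coin))))"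
  have "expected_output V w prec c D arr q = (\<Sum>x\<in>set_pmf D. pmf D x *\<^sub>R (case x of (I, S) \<Rightarrow> ?E I S))"
    unfolding expected_output_def alg_output_def
    by (subst pmf_expectation_bind[of "set_pmf D"])
      (auto simp: finite_support finite_coins case_prod_unfold)
  also have "\<dots> = Ex ?E"
    by (rule integral_measure_pmf[symmetric]) (auto simp: finite_support)
  finally show ?thesis
    using arr q by (simp only:) (intro Ex_mono expected_card_M4_ge, auto simp: arrival_order_def)
qed

text \<open>By Bernoulli's inequality the loss per candidate is at most \<open>q\<close> times its
  number of conflicts, and each conflict weighs at least \<open>1 / ?L\<close>. The total loss is
  thus at most \<open>t\<close> times the weight over ordered pairs in \<open>M2\<close>.\<close>

lemma survivors_ge:
  assumes I: "I \<subseteq> V" and q: "0 \<le> q" "q \<le> 1"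
    and t: "q * (4 * exp 1 * log 2 (n_tilde c S)) \<le> t" and log_pos: "0 < log 2 (n_tilde c S)"
  shows "real (card (M2 I S)) - 2 * t * (\<Sum>v\<in>M2 I S. mass S v) \<le>
    (\<Sum>v\<in>M2 I S. (1 - q) ^ card (conflicts I S v))"
proof -
  let ?L = "4 * exp 1 * log 2 (n_tilde c S)"
  have L: "0 < ?L"
    using log_pos by simp
  have "0 \<le> t"
    using t q(1) L by (smt (verit) mult_nonneg_nonneg)
  have fin: "finite (M2 I S)" and sub: "M2 I S \<subseteq> V"
    using finite_M2[OF I] I by (auto simp: M2_def)
  have conf: "q * card (conflicts I S v) \<le> t * (\<Sum>u\<in>M2 I S - {v}. wbar w u v)" if v: "v \<in> M2 I S" for v
  proof -
    have "card (conflicts I S v) * (1 / ?L) = (\<Sum>u\<in>conflicts I S v. 1 / ?L)"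
      by simp
    also have "\<dots> \<le> (\<Sum>u\<in>conflicts I S v. wbar w u v)"
      by (intro sum_mono) (auto simp: conflicts_def)
    also have "\<dots> \<le> (\<Sum>u\<in>M2 I S - {v}. wbar w u v)"
      using fin sub v by (intro sum_mono2) (auto simp: conflicts_def intro!: wbar_nonneg)
    finally have "card (conflicts I S v) \<le> ?L * (\<Sum>u\<in>M2 I S - {v}. wbar w u v)"
      using L by (simp add: field_simps)
    then have "q * card (conflicts I S v) \<le> (q * ?L) * (\<Sum>u\<in>M2 I S - {v}. wbar w u v)"
      using q(1) by (metis mult.assoc mult_left_mono)
    also have "\<dots> \<le> t * (\<Sum>u\<in>M2 I S - {v}. wbar w u v)"
      using t sub v by (intro mult_right_mono sum_nonneg wbar_nonneg) auto
    finally show ?thesis .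
  qed
  have "real (card (M2 I S)) - 2 * t * (\<Sum>v\<in>M2 I S. mass S v) \<le>
      real (card (M2 I S)) - t * (\<Sum>v\<in>M2 I S. \<Sum>u\<in>M2 I S - {v}. wbar w u v)"
    using mult_left_mono[OF M2_pairs_le[OF I, of S] \<open>0 \<le> t\<close>] by (simp add: mult.left_commute)
  also have "\<dots> = (\<Sum>v\<in>M2 I S. 1 - t * (\<Sum>u\<in>M2 I S - {v}. wbar w u v))"
    by (simp add: sum_subtractf sum_distrib_left)
  also have "\<dots> \<le> (\<Sum>v\<in>M2 I S. (1 - q) ^ card (conflicts I S v))"
  proof (rule sum_mono)
    fix v assume "v \<in> M2 I S"
    then show "1 - t * (\<Sum>u\<in>M2 I S - {v}. wbar w u v) \<le> (1 - q) ^ card (conflicts I S v)"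
      using conf[of v] Bernoulli_inequality[of "- q" "card (conflicts I S v)"] q
      by (simp add: mult.commute)
  qed
  finally show ?thesis .
qed

text \<open>By independence each node contributes a factor, at most 1 - 1 / (2 (1 + c)) because
  \<open>exp (- 1)\<close> is at most 1/2.\<close>

lemma Ex_exp_card_le:
  assumes "A \<subseteq> V"
  shows "Ex (\<lambda>I S. exp (- real (card (S \<inter> A)))) \<le> exp (- (real (card A) / (2 * (1 + c))))"
  using finite_subset[OF assms finite_nodes] assms
proof (induction rule: finite_induct)
  case (insert v A)
  let ?p = "1 / (2 * (1 + c))"
  have v: "v \<in> V" using insert by simp
  have "Ex (\<lambda>I S. exp (- real (card (S \<inter> insert v A)))) =
      Ex (\<lambda>I S. exp (- real (card (S \<inter> A))) * (1 - (1 - exp (- 1)) * of_bool (v \<in> S)))"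
  proof (rule Ex_cong)
    fix I S assume "S \<subseteq> V"
    then have "finite (S \<inter> A)" using insert by auto
    then show "exp (- real (card (S \<inter> insert v A))) =
        exp (- real (card (S \<inter> A))) * (1 - (1 - exp (- 1)) * of_bool (v \<in> S))"
      using insert by (simp add: Int_insert_right exp_add[symmetric])
  qed
  also have "\<dots> = Ex (\<lambda>I S. exp (- real (card (S \<inter> A)))) * Ex (\<lambda>I S. 1 - (1 - exp (- 1)) * of_bool (v \<in> S))"
    using insert by (intro Ex_indep[OF v, where h = "\<lambda>i s. 1 - (1 - exp (- 1)) * of_bool s"])
      (simp add: Diff_Int_distrib2)
  also have "\<dots> \<le> exp (- (real (card A) / (2 * (1 + c)))) * exp (- ?p)"
  proof (rule mult_mono)
    show "Ex (\<lambda>I S. exp (- real (card (S \<inter> A)))) \<le> exp (- (real (card A) / (2 * (1 + c))))"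
      using insert by simp
    have "exp (- 1) \<le> (1 / 2 :: real)"
      using exp_ge_add_one_self[of 1] by (simp add: exp_minus field_simps)
    then have "(1 / 2) * (1 / (1 + c)) \<le> (1 - exp (- 1)) * pS v"
      using pS_ge[OF v] c_ge_1 by (intro mult_mono) auto
    moreover have "Ex (\<lambda>I S. 1 - (1 - exp (- 1)) * of_bool (v \<in> S)) = 1 - (1 - exp (- 1)) * pS v"
      by (simp only: Ex_diff Ex_cmult Ex_of_bool Ex_const)
    ultimately show "Ex (\<lambda>I S. 1 - (1 - exp (- 1)) * of_bool (v \<in> S)) \<le> exp (- ?p)"
      using exp_ge_add_one_self[of "- ?p"] by simp
    show "0 \<le> Ex (\<lambda>I S. 1 - (1 - exp (- 1)) * of_bool (v \<in> S))"
      by (rule Ex_nonneg) (simp add: of_bool_def)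
  qed simp
  also have "\<dots> = exp (- (real (card (insert v A)) / (2 * (1 + c))))"
    using insert by (simp add: exp_add[symmetric] add_divide_distrib)
  finally show ?case .
qed simp

text \<open>Chernoff's method with the preceding moment bound; the threshold spends half of its
  exponent.\<close>

lemma small_sample:
  "Ex (\<lambda>I S. of_bool (real (card S) < card V / (4 * (1 + c)))) \<le> exp (- (card V / (4 * (1 + c))))"
proof -
  let ?t = "card V / (4 * (1 + c))"
  have "Ex (\<lambda>I S. of_bool (real (card S) < ?t)) \<le> Ex (\<lambda>I S. exp ?t * exp (- real (card (S \<inter> V))))"
    by (rule Ex_mono) (auto simp: of_bool_def exp_add[symmetric] Int_absorb2)
  also have "\<dots> = exp ?t * Ex (\<lambda>I S. exp (- real (card (S \<inter> V))))"
    by (rule Ex_cmult)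
  also have "\<dots> \<le> exp ?t * exp (- (card V / (2 * (1 + c))))"
    using Ex_exp_card_le[of V] by (intro mult_left_mono) auto
  also have "card V / (2 * (1 + c)) = 2 * ?t"
    using c_ge_1 by (simp add: divide_simps)
  also have "exp ?t * exp (- (2 * ?t)) = exp (- ?t)"
    by (simp only: exp_add[symmetric]) simp
  finally show ?thesis .
qed

text \<open>Independence and positive marginals give the full sample positive probability. A
  constant \<open>q\<close> must therefore respect \<open>q_max\<close> at \<open>V\<close> as
  well.\<close>

lemma full_sample_possible: "\<exists>I. (I, V) \<in> set_pmf D"
proof -
  have "0 < Ex (\<lambda>I S. of_bool (A \<subseteq> S))" if "A \<subseteq> V" for A
    using finite_subset[OF that finite_nodes] that
  proof (induction rule: finite_induct)
    case (insert v A)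
    have v: "v \<in> V" using insert by simp
    have "Ex (\<lambda>I S. of_bool (insert v A \<subseteq> S)) = Ex (\<lambda>I S. of_bool (A \<subseteq> S) * of_bool (v \<in> S))"
      by (rule Ex_cong) auto
    also have "\<dots> = Ex (\<lambda>I S. of_bool (A \<subseteq> S)) * Ex (\<lambda>I S. of_bool (v \<in> S))"
      using insert by (intro Ex_indep[OF v, where h = "\<lambda>i s. of_bool s"]) auto
    also have "\<dots> = Ex (\<lambda>I S. of_bool (A \<subseteq> S)) * pS v"
      by (simp only: Ex_of_bool)
    also have "\<dots> > 0"
      using insert pS_ge[OF v] c_ge_1 by (intro mult_pos_pos) (auto intro: less_le_trans[rotated])
    finally show ?case .
  qed simp
  from this[of V] have "Ex (\<lambda>I S. of_bool (V \<subseteq> S)) \<noteq> Ex (\<lambda>I S. 0)"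
    by simp
  then obtain I S where "(I, S) \<in> set_pmf D" "S \<subseteq> V" "V \<subseteq> S"
    using Ex_cong[of "\<lambda>I S. of_bool (V \<subseteq> S)" "\<lambda>I S. 0"] by fastforce
  then show ?thesis
    by auto
qed

end

section \<open>Choice of the coin probability\<close>

lemma n_tilde_ge_3: "1 \<le> c \<Longrightarrow> 3 \<le> n_tilde c S"
  using mult_mono[of 3 "c + 2" 1 "real (max 1 (card S))"] by (simp add: n_tilde_def)

text \<open>The constant comes from 8 \<le> 9. It suffices for the comparison with
  \<open>budget_le\<close>, since 3 (2 (3/2) + 1) = 12 exceeds 32/3.\<close>

lemma log_n_tilde_ge:
  assumes "1 \<le> c"
  shows "3 / 2 \<le> log 2 (n_tilde c S)"
proof -
  have "3 = log 2 (2 ^ 3 :: real)"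
    by (subst log_nat_power) auto
  also have "\<dots> \<le> log 2 (3 ^ 2)"
    by (subst log_le_cancel_iff) auto
  also have "\<dots> = 2 * log 2 3"
    by (subst log_nat_power) auto
  also have "\<dots> \<le> 2 * log 2 (n_tilde c S)"
    using n_tilde_ge_3[OF assms, of S] by simp
  finally show ?thesis
    by simp
qed

lemma n_tilde_mono: "0 \<le> c \<Longrightarrow> card S \<le> card S' \<Longrightarrow> n_tilde c S \<le> n_tilde c S'"
  unfolding n_tilde_def by (intro mult_left_mono) auto

lemma tau_mono:
  assumes "1 \<le> c" "0 \<le> r" "0 < m" "m \<le> m'"
  shows "tau c r m \<le> tau c r m'"
proof -
  have "of_int \<lceil>log 2 m\<rceil> \<le> (of_int \<lceil>log 2 m'\<rceil> :: real)"
    using assms by (simp add: ceiling_mono)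
  then show ?thesis
    unfolding tau_def using assms
    by (intro mult_left_mono add_right_mono) auto
qed

text \<open>Removes \<open>r\<close> and the ceiling, leaving the form that is compared with the
  expected weight inside \<open>M2\<close>.\<close>

lemma tau_ge:
  assumes "1 \<le> c" "1 \<le> r" "1 \<le> m"
  shows "3 * (1 + c)\<^sup>2 * (2 * log 2 m + 1) \<le> tau c r m"
proof -
  have "0 \<le> log 2 m"
    using assms by simp
  have "3 * (1 + c)\<^sup>2 * c \<le> 3 * (1 + c)\<^sup>2 * (1 + c)"
    using assms by (intro mult_left_mono) auto
  also have "\<dots> = 3 * (1 + c) ^ 3"
    by (simp add: power2_eq_square power3_eq_cube)
  finally have "3 * (1 + c)\<^sup>2 \<le> (3 * (1 + c) ^ 3 + c) / c"
    using assms by (subst pos_le_divide_eq) auto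
  moreover have "log 2 m \<le> r * of_int \<lceil>log 2 m\<rceil>"
    using assms \<open>0 \<le> log 2 m\<close> mult_mono[of 1 r "log 2 m" "of_int \<lceil>log 2 m\<rceil>"] by simp
  ultimately show ?thesis
    unfolding tau_def using \<open>0 \<le> log 2 m\<close> assms by (intro mult_mono) auto
qed

lemma tau_n_tilde_ge_1:
  assumes "1 \<le> c" "1 \<le> r"
  shows "1 \<le> tau c r (n_tilde c S)"
proof -
  have "1 \<le> (1 + c)\<^sup>2"
    using assms by simp
  then have "1 * 1 \<le> 3 * (1 + c)\<^sup>2 * (2 * log 2 (n_tilde c S) + 1)"
    using log_n_tilde_ge[OF assms(1), of S] by (intro mult_mono) auto
  also have "\<dots> \<le> tau c r (n_tilde c S)"
    using n_tilde_ge_3[OF assms(1), of S] assms by (intro tau_ge) auto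
  finally show ?thesis
    by simp
qed

lemma q_max_denominator_ge:
  assumes "1 \<le> c" "1 \<le> r"
  shows "2 \<le> 4 * exp 1 * log 2 (n_tilde c S) * tau c r (n_tilde c S)"
proof -
  have "2 * 1 * 1 \<le> 4 * exp 1 * log 2 (n_tilde c S) * tau c r (n_tilde c S)"
    using log_n_tilde_ge[OF assms(1), of S] tau_n_tilde_ge_1[OF assms, of S] exp_ge_add_one_self[of 1]
    by (intro mult_mono) auto
  then show ?thesis
    by simp
qed

lemma q_max_pos: "1 \<le> c \<Longrightarrow> 1 \<le> r \<Longrightarrow> 0 < q_max c r S"
  using q_max_denominator_ge[of c r S] by (simp add: q_max_def)

lemma q_max_le_half: "1 \<le> c \<Longrightarrow> 1 \<le> r \<Longrightarrow> q_max c r S \<le> 1 / 2"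
  using q_max_denominator_ge[of c r S] unfolding q_max_def by (intro divide_left_mono) auto

lemma q_max_range: "1 \<le> c \<Longrightarrow> 1 \<le> r \<Longrightarrow> 0 \<le> q_max c r S \<and> q_max c r S \<le> 1"
  using q_max_pos[of c r S] q_max_le_half[of c r S] by simp

text \<open>Makes \<open>q_max\<close> at \<open>V\<close> a lower bound for every coin probability;
  only small samples can make the coin too large.\<close>

lemma q_max_antimono:
  assumes "1 \<le> c" "1 \<le> r" "card S \<le> card S'"
  shows "q_max c r S' \<le> q_max c r S"
proof -
  have le: "n_tilde c S \<le> n_tilde c S'" and "0 < n_tilde c S"
    using n_tilde_mono[of c S S'] n_tilde_ge_3[of c S] assms by auto
  then have "log 2 (n_tilde c S) \<le> log 2 (n_tilde c S')"
    "tau c r (n_tilde c S) \<le> tau c r (n_tilde c S')"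
    using assms by (auto intro: tau_mono)
  then have "4 * exp 1 * log 2 (n_tilde c S) * tau c r (n_tilde c S) \<le>
      4 * exp 1 * log 2 (n_tilde c S') * tau c r (n_tilde c S')"
    using log_n_tilde_ge[OF assms(1), of S] log_n_tilde_ge[OF assms(1), of S'] tau_n_tilde_ge_1[of c r S] assms(1,2)
    by (intro mult_mono) auto
  then show ?thesis
    unfolding q_max_def using q_max_denominator_ge[OF assms(1,2), of S] by (intro frac_le) linarith+
qed

lemma le_q_max_mult:
  assumes "1 \<le> c" "1 \<le> r" "q \<le> q_max c r S"
  shows "q * (4 * exp 1 * log 2 (n_tilde c S)) \<le> 1 / tau c r (n_tilde c S)"
proof -
  have "0 < log 2 (n_tilde c S)" "0 < tau c r (n_tilde c S)"
    using log_n_tilde_ge[OF assms(1), of S] tau_n_tilde_ge_1[OF assms(1,2), of S] by auto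
  then show ?thesis
    using assms(3) by (simp add: q_max_def field_simps)
qed

text \<open>The left side is four times the factor in \<open>Ex_mass_M2_le\<close>: once
  \<open>t\<close> dominates it, \<open>2 * (1 / t)\<close> times that factor is at most
  1/2.\<close>

lemma budget_le:
  assumes "1 \<le> c" "1 \<le> (n :: real)"
  shows "4 * (8 * (1 + c) / 3 * (ln n + 1 + c)) \<le> (1 + c)\<^sup>2 * (16 / 3 * log 2 n + 32 / 3)"
proof -
  have "ln 2 \<le> (1 :: real)"
    using ln_le_minus_one[of 2] by simp
  then have "ln n \<le> log 2 n"
    using assms by (simp add: log_def field_simps mult_left_le)
  then have "(1 + c) * ln n \<le> (1 + c) * log 2 n"
    using assms by (intro mult_left_mono) auto
  \<comment> \<open>Using 2 \<le> 1 + c here yields the second factor 1 + c.\<close>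
  moreover have "2 * ln n \<le> (1 + c) * ln n"
    using assms by (intro mult_right_mono) auto
  ultimately have "2 * ln n \<le> (1 + c) * log 2 n"
    by (rule order_trans[rotated])
  then have "4 * (8 / 3 * (ln n + 1 + c)) \<le> 16 / 3 * ((1 + c) * log 2 n) + 32 / 3 * (1 + c)"
    by (simp add: field_simps)
  also have "\<dots> = (1 + c) * (16 / 3 * log 2 n + 32 / 3)"
    by (simp add: field_simps)
  finally have "4 * (8 / 3 * (ln n + 1 + c)) \<le> (1 + c) * (16 / 3 * log 2 n + 32 / 3)" .
  then have "(1 + c) * (4 * (8 / 3 * (ln n + 1 + c))) \<le> (1 + c) * ((1 + c) * (16 / 3 * log 2 n + 32 / 3))"
    using assms by (intro mult_left_mono) auto
  moreover have "4 * (8 * (1 + c) / 3 * (ln n + 1 + c)) = (1 + c) * (4 * (8 / 3 * (ln n + 1 + c)))"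
    by (simp add: algebra_simps)
  ultimately show ?thesis
    by (simp only: power2_eq_square mult.assoc)
qed

text \<open>Two nodes make \<open>log 2 (card S)\<close> at least 1, so the additive terms from
  \<open>c + 2\<close>, the ceiling and \<open>tau\<close> are absorbed into multiples of it. The
  remaining constant depends on \<open>c\<close> only.\<close>

lemma inverse_q_max_le:
  assumes "1 \<le> c" "1 \<le> r" "2 \<le> card S"
  defines "a \<equiv> log 2 (c + 2) + 1"
  shows "1 / q_max c r S \<le>
    4 * exp 1 * a * ((3 * (1 + c) ^ 3 + c) / c) * (2 * a + 3) * r * (log 2 (card S))\<^sup>2"
proof -
  define l where "l = log 2 (real (card S))"
  define L where "L = log 2 (n_tilde c S)"
  define t where "t = (3 * (1 + c) ^ 3 + c) / c"
  have "0 < t"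
    using assms by (simp add: t_def divide_pos_pos add_pos_pos)
  have l: "1 \<le> l"
    using assms by (simp add: l_def le_log_iff)
  have a: "1 \<le> a"
    using assms by (simp add: a_def)
  have "L = log 2 (c + 2) + l"
    using assms by (simp add: L_def l_def n_tilde_def log_mult max_def)
  also have "\<dots> \<le> log 2 (c + 2) * l + 1 * l"
    using l assms mult_left_mono[of 1 l "log 2 (c + 2)"] by simp
  also have "\<dots> = a * l"
    by (simp add: a_def algebra_simps)
  finally have L: "L \<le> a * l" .
  have "0 \<le> L"
    using log_n_tilde_ge[OF assms(1), of S] by (simp add: L_def)
  have "of_int \<lceil>L\<rceil> \<le> a * l + 1"
    using L by linarith
  then have "2 * r * of_int \<lceil>L\<rceil> + 1 \<le> 2 * r * (a * l + 1) + 1"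
    using assms by (intro add_right_mono mult_left_mono) auto
  also have "\<dots> = 2 * a * (r * l) + 2 * r + 1"
    by (simp add: algebra_simps)
  also have "\<dots> \<le> 2 * a * (r * l) + 2 * (r * l) + r * l"
    using mult_mono[of 1 r 1 l] mult_left_mono[of 1 l r] assms l by (intro add_mono) auto
  also have "\<dots> = (2 * a + 3) * r * l"
    by (simp add: algebra_simps)
  finally have R: "2 * r * of_int \<lceil>L\<rceil> + 1 \<le> (2 * a + 3) * r * l" .
  have "0 \<le> 2 * r * of_int \<lceil>L\<rceil> + 1"
    using \<open>0 \<le> L\<close> assms by (intro add_nonneg_nonneg mult_nonneg_nonneg) auto
  have "1 / q_max c r S = 4 * exp 1 * L * (t * (2 * r * of_int \<lceil>L\<rceil> + 1))"
    by (simp add: q_max_def tau_def L_def t_def)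
  also have "\<dots> \<le> 4 * exp 1 * (a * l) * (t * ((2 * a + 3) * r * l))"
    using L R \<open>0 < t\<close> \<open>0 \<le> 2 * r * of_int \<lceil>L\<rceil> + 1\<close> \<open>0 \<le> L\<close> a l
    by (intro mult_mono mult_left_mono mult_nonneg_nonneg) auto
  also have "\<dots> = 4 * exp 1 * a * t * (2 * a + 3) * r * l\<^sup>2"
    by (simp add: power2_eq_square mult_ac)
  finally show ?thesis
    by (simp add: l_def t_def)
qed

section \<open>Comparing optima and output with the expected candidate set\<close>

context ordered_graph_sampling
begin

abbreviation EM2 :: real where
  "EM2 \<equiv> Ex (\<lambda>I S. real (card (M2 I S)))"

lemma card_subset_V: "S \<subseteq> V \<Longrightarrow> card S \<le> card V"
  by (simp add: card_mono finite_nodes)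

lemma card_V_ge_1: "V \<noteq> {} \<Longrightarrow> 1 \<le> real (card V)"
  using finite_nodes by (simp add: Suc_le_eq card_gt_0_iff)

lemma log_n_tilde_pos: "0 < log 2 (n_tilde c S)"
  using log_n_tilde_ge[OF c_ge_1, of S] by simp

lemma expected_OPT_S_le:
  assumes "inductive_order V w prec r" "1 \<le> r"
  shows "expected_OPT_S w D \<le> 2 * r * Ex (\<lambda>I S. real (card (M1 w prec S)))"
  unfolding expected_OPT_S_def Ex_cmult[symmetric]
  using OPT_le_M1[OF assms] by (rule Ex_mono)

text \<open>This is where the factor \<open>c\<close> enters: arrival may be \<open>c\<close> times
  rarer than sampling.\<close>

lemma Ex_card_M1_le_c_EM2: "Ex (\<lambda>I S. real (card (M1 w prec S))) \<le> c * EM2"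
proof -
  have "pS v \<le> c * pI v" if "v \<in> V" for v
    using ratio_lower[OF that] c_ge_1 by (simp add: field_simps)
  then show ?thesis
    unfolding Ex_card_M1 Ex_card_M2 sum_distrib_left mult.assoc[symmetric]
    by (intro sum_mono mult_right_mono Ex_nonneg) auto
qed

lemma Ex_card_M1_le_EM2:
  assumes "\<And>v. v \<in> V \<Longrightarrow> pS v \<le> pI v"
  shows "Ex (\<lambda>I S. real (card (M1 w prec S))) \<le> EM2"
  unfolding Ex_card_M1 Ex_card_M2
  using assms by (intro sum_mono mult_right_mono Ex_nonneg) auto

text \<open>An optimum \<open>T\<close> of the whole graph bounds every \<open>OPT w I\<close>, and
  \<open>T \<inter> S\<close> is a feasible solution keeping each node of \<open>T\<close> with
  probability at least 1 / (1 + c).\<close>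

lemma expected_OPT_I_le: "expected_OPT_I w D \<le> (1 + c) * expected_OPT_S w D"
proof -
  obtain T where T: "T \<subseteq> V" "independent_set w T" "OPT w V = card T"
    using OPT_attained[of V] by blast
  have finT: "finite T"
    using T finite_nodes finite_subset by blast
  have "OPT w I \<le> card T" if "I \<subseteq> V" for I
    using OPT_attained[OF that] card_le_OPT[of V] that T(3) by (metis order_refl order_trans)
  then have "expected_OPT_I w D \<le> Ex (\<lambda>I S. real (card T))"
    unfolding expected_OPT_I_def by (intro Ex_mono) simp
  then have OPT_I: "expected_OPT_I w D \<le> card T"
    by simp
  have "card T / (1 + c) = (\<Sum>v\<in>T. 1 / (1 + c))"
    by simp
  also have "\<dots> \<le> (\<Sum>v\<in>T. pS v)"
    using pS_ge T by (intro sum_mono) auto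
  also have "\<dots> = Ex (\<lambda>I S. \<Sum>v\<in>T. of_bool (v \<in> S))"
    by (simp only: Ex_sum Ex_of_bool)
  also have "\<dots> \<le> expected_OPT_S w D"
    unfolding expected_OPT_S_def
  proof (rule Ex_mono)
    fix I S assume S: "S \<subseteq> V"
    have "card (T \<inter> S) \<le> OPT w S"
      using T S independent_set_mono[OF T(2), of "T \<inter> S"] by (intro card_le_OPT) auto
    then show "(\<Sum>v\<in>T. of_bool (v \<in> S)) \<le> real (OPT w S)"
      using finT by (simp add: sum_of_bool_eq Int_def)
  qed
  finally have "card T \<le> (1 + c) * expected_OPT_S w D"
    using c_ge_1 by (simp add: field_simps)
  with OPT_I show ?thesis
    by linarith
qed

text \<open>The value of \<open>tau\<close> at \<open>V\<close> is large enough that conflicts cost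
  at most half of \<open>EM2\<close> in expectation.\<close>

lemma expected_output_constant_ge:
  assumes V: "V \<noteq> {}" and arr: "arrival_order D arr" and r: "1 \<le> r"
    and q: "0 \<le> q" "q \<le> q_max c r V"
  shows "q / 2 * EM2 \<le> expected_output V w prec c D arr (\<lambda>_. q)"
proof -
  define t where "t = tau c r (n_tilde c V)"
  have t: "1 \<le> t"
    unfolding t_def by (rule tau_n_tilde_ge_1[OF c_ge_1 r])
  have q1: "q \<le> 1"
    using q q_max_le_half[OF c_ge_1 r, of V] by simp
  have m: "0 \<le> EM2"
    by (rule Ex_nonneg) simp
  have "4 * (8 * (1 + c) / 3 * (ln (card V) + 1 + c)) \<le> (1 + c)\<^sup>2 * (16 / 3 * log 2 (card V) + 32 / 3)"
    by (rule budget_le[OF c_ge_1 card_V_ge_1[OF V]])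
  also have "\<dots> \<le> (1 + c)\<^sup>2 * (3 * (2 * log 2 (n_tilde c V) + 1))"
  proof (intro mult_left_mono)
    \<comment> \<open>By the convention for the empty sample, \<open>n_tilde c {}\<close> is just
      \<open>c + 2\<close>, which makes \<open>log_n_tilde_ge\<close> applicable to that
      factor.\<close>
    have eq: "n_tilde c V = n_tilde c ({} :: 'a set) * card V"
      using card_V_ge_1[OF V] by (auto simp: n_tilde_def max_def)
    have "log 2 (n_tilde c V) = log 2 (n_tilde c ({} :: 'a set)) + log 2 (card V)"
      unfolding eq using card_V_ge_1[OF V] n_tilde_ge_3[OF c_ge_1, of "{} :: 'a set"]
      by (intro log_mult_pos) linarith+
    moreover have "0 \<le> log 2 (card V)"
      using card_V_ge_1[OF V] by simp
    ultimately show "16 / 3 * log 2 (card V) + 32 / 3 \<le> 3 * (2 * log 2 (n_tilde c V) + 1)"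
      using log_n_tilde_ge[OF c_ge_1, of "{} :: 'a set"] by simp
  qed simp
  also have "\<dots> = 3 * (1 + c)\<^sup>2 * (2 * log 2 (n_tilde c V) + 1)"
    by simp
  also have "\<dots> \<le> t"
    unfolding t_def using n_tilde_ge_3[OF c_ge_1, of V] by (intro tau_ge[OF c_ge_1 r]) simp
  finally have "2 * (1 / t) * (8 * (1 + c) / 3 * (ln (card V) + 1 + c)) \<le> 1 / 2"
    using t by (simp add: field_simps)
  from mult_right_mono[OF this m]
  have mass: "2 * (1 / t) * Ex (\<lambda>I S. \<Sum>v\<in>M2 I S. mass S v) \<le> 1 / 2 * EM2"
    using mult_left_mono[OF Ex_mass_M2_le[OF V], of "2 * (1 / t)"] t by (simp add: mult.assoc)
  have "q / 2 * EM2 = q * (EM2 - 1 / 2 * EM2)"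
    by simp
  also have "\<dots> \<le> q * (EM2 - 2 * (1 / t) * Ex (\<lambda>I S. \<Sum>v\<in>M2 I S. mass S v))"
    by (intro mult_left_mono diff_left_mono mass q)
  also have "\<dots> = Ex (\<lambda>I S. q * (card (M2 I S) - 2 * (1 / t) * (\<Sum>v\<in>M2 I S. mass S v)))"
    by (simp only: Ex_cmult Ex_diff)
  also have "\<dots> \<le> Ex (\<lambda>I S. \<Sum>v\<in>M2 I S. q * (1 - q) ^ card (conflicts I S v))"
    unfolding sum_distrib_left[symmetric]
  proof (intro Ex_mono mult_left_mono survivors_ge q1 q log_n_tilde_pos)
    fix I S assume "S \<subseteq> V"
    then have "log 2 (n_tilde c S) \<le> log 2 (n_tilde c V)"
      using n_tilde_mono[of c S V] card_subset_V[of S] n_tilde_ge_3[OF c_ge_1, of S] c_ge_1 by simp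
    then have "q * (4 * exp 1 * log 2 (n_tilde c S)) \<le> q * (4 * exp 1 * log 2 (n_tilde c V))"
      using q by (intro mult_left_mono) auto
    also have "\<dots> \<le> 1 / t"
      unfolding t_def by (rule le_q_max_mult[OF c_ge_1 r q(2)])
    finally show "q * (4 * exp 1 * log 2 (n_tilde c S)) \<le> 1 / t" .
  qed
  also have "\<dots> \<le> expected_output V w prec c D arr (\<lambda>_. q)"
    using expected_output_ge[OF arr, of "\<lambda>_. q"] q q1 by simp
  finally show ?thesis .
qed

text \<open>Every coin probability lies between \<open>q_max c r V\<close> and 1/2, and a node has
  at most \<open>card V\<close> conflicts; no control of the weight is required.\<close>

lemma expected_output_q_max_ge_small:
  assumes arr: "arrival_order D arr" and r: "1 \<le> r"
  shows "(1 / 2) ^ card V * q_max c r V * EM2 \<le> expected_output V w prec c D arr (q_max c r)"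
proof -
  have "(1 / 2) ^ card V * q_max c r V * EM2 = Ex (\<lambda>I S. (q_max c r V * (1 / 2) ^ card V) * card (M2 I S))"
    by (subst Ex_cmult) (simp add: mult_ac)
  also have "\<dots> \<le> Ex (\<lambda>I S. \<Sum>v\<in>M2 I S. q_max c r S * (1 - q_max c r S) ^ card (conflicts I S v))"
  proof (rule Ex_mono)
    fix I S assume "I \<subseteq> V" "S \<subseteq> V"
    let ?q = "q_max c r S"
    have "card (conflicts I S v) \<le> card V" for v
      using \<open>I \<subseteq> V\<close> by (intro card_subset_V) (auto simp: conflicts_def M2_def)
    then have "(1 / 2) ^ card V \<le> (1 / 2 :: real) ^ card (conflicts I S v)" for v
      by (intro power_decreasing) auto
    also have "(1 / 2) ^ card (conflicts I S v) \<le> (1 - ?q) ^ card (conflicts I S v)" for v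
      using q_max_le_half[OF c_ge_1 r, of S] by (intro power_mono) auto
    finally have "q_max c r V * (1 / 2) ^ card V \<le> ?q * (1 - ?q) ^ card (conflicts I S v)" for v
      using q_max_antimono[OF c_ge_1 r card_subset_V[OF \<open>S \<subseteq> V\<close>]] q_max_pos[OF c_ge_1 r, of S]
      by (intro mult_mono) auto
    then have "(\<Sum>v\<in>M2 I S. q_max c r V * (1 / 2) ^ card V) \<le>
        (\<Sum>v\<in>M2 I S. ?q * (1 - ?q) ^ card (conflicts I S v))"
      by (intro sum_mono)
    then show "(q_max c r V * (1 / 2) ^ card V) * card (M2 I S) \<le>
        (\<Sum>v\<in>M2 I S. ?q * (1 - ?q) ^ card (conflicts I S v))"
      by (simp add: mult_ac)
  qed
  also have "\<dots> \<le> expected_output V w prec c D arr (q_max c r)"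
    using q_max_range[OF c_ge_1 r] by (rule expected_output_ge[OF arr])
  finally show ?thesis .
qed

text \<open>Conflicts cost at most half of \<open>EM2\<close>. Small samples lose at most
  \<open>card V\<close> nodes each but are so unlikely that they cost at most another
  quarter.\<close>

lemma expected_output_q_max_ge_large:
  assumes V: "V \<noteq> {}" and arr: "arrival_order D arr" and r: "1 \<le> r"
    and large: "card V * exp (- (card V / (4 * (1 + c)))) \<le> 1 / (4 * (1 + c))" "30 \<le> log 2 (card V)"
  shows "1 / 4 * q_max c r V * EM2 \<le> expected_output V w prec c D arr (q_max c r)"
proof -
  let ?n = "real (card V)"
  let ?small = "\<lambda>S. real (card S) < ?n / (4 * (1 + c))"
  let ?mass = "\<lambda>I S. \<Sum>v\<in>M2 I S. mass S v"
  \<comment> \<open>A sample that is not small has \<open>n_tilde\<close> at least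
    \<open>?n / 4\<close>, so \<open>t\<close> is a lower bound for \<open>tau\<close> on all such
    samples.\<close>
  define t where "t = 3 * (1 + c)\<^sup>2 * (2 * log 2 (?n / 4) + 1)"
  have n: "1 \<le> ?n"
    by (rule card_V_ge_1[OF V])
  have log_n4: "log 2 (?n / 4) = log 2 ?n - 2"
  proof -
    have "log 2 (4 :: real) = log 2 (2 ^ 2)" by simp
    also have "\<dots> = 2" by (subst log_nat_power) auto
    finally show ?thesis using n by (simp add: log_divide)
  qed
  have n4: "1 \<le> ?n / 4"
  proof -
    have "0 < log 2 (?n / 4)" using log_n4 large by simp
    then show ?thesis using n by simp
  qed
  have t: "0 < t"
    using log_n4 large c_ge_1 by (auto simp: t_def intro!: mult_pos_pos)
  have m: "0 \<le> EM2"
    by (rule Ex_nonneg) simp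
  have "4 * (8 * (1 + c) / 3 * (ln ?n + 1 + c)) \<le> (1 + c)\<^sup>2 * (16 / 3 * log 2 ?n + 32 / 3)"
    by (rule budget_le[OF c_ge_1 n])
  \<comment> \<open>With x = \<open>log 2 ?n\<close> this reads 16 x / 3 + 32 / 3 \<le> 6 x - 9,
    true from x = 29.5 on; hence the assumed 30.\<close>
  also have "\<dots> \<le> (1 + c)\<^sup>2 * (3 * (2 * log 2 (?n / 4) + 1))"
    using large log_n4 by (intro mult_left_mono) auto
  also have "\<dots> = t"
    by (simp add: t_def)
  finally have "2 * (1 / t) * (8 * (1 + c) / 3 * (ln ?n + 1 + c)) \<le> 1 / 2"
    using t by (simp add: field_simps)
  from mult_right_mono[OF this m]
  have mass: "2 * (1 / t) * Ex ?mass \<le> 1 / 2 * EM2"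
    using mult_left_mono[OF Ex_mass_M2_le[OF V], of "2 * (1 / t)"] t by (simp add: mult.assoc)
  have "?n * Ex (\<lambda>I S. of_bool (?small S)) \<le> ?n * exp (- (?n / (4 * (1 + c))))"
    by (intro mult_left_mono small_sample) simp
  also have "\<dots> \<le> 1 / 4 * (1 / (1 + c))"
    using large by simp
  also have "\<dots> \<le> 1 / 4 * EM2"
    by (intro mult_left_mono Ex_card_M2_ge[OF V]) simp
  finally have small: "?n * Ex (\<lambda>I S. of_bool (?small S)) \<le> 1 / 4 * EM2" .
  have "1 / 4 * q_max c r V * EM2 \<le>
      q_max c r V * (EM2 - ?n * Ex (\<lambda>I S. of_bool (?small S)) - 2 * (1 / t) * Ex ?mass)"
    using mult_left_mono[of "1 / 4 * EM2" "EM2 - ?n * Ex (\<lambda>I S. of_bool (?small S)) - 2 * (1 / t) * Ex ?mass" "q_max c r V"]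
      mass small q_max_pos[OF c_ge_1 r, of V] by (simp add: mult_ac)
  also have "\<dots> = Ex (\<lambda>I S. q_max c r V * (card (M2 I S) - ?n * of_bool (?small S) - 2 * (1 / t) * ?mass I S))"
    by (simp only: Ex_cmult Ex_diff)
  also have "\<dots> \<le> Ex (\<lambda>I S. \<Sum>v\<in>M2 I S. q_max c r S * (1 - q_max c r S) ^ card (conflicts I S v))"
    unfolding sum_distrib_left[symmetric]
  proof (rule Ex_mono)
    fix I S assume I: "I \<subseteq> V" and S: "S \<subseteq> V"
    let ?q = "q_max c r S"
    have q: "0 < ?q" "?q \<le> 1 / 2"
      using q_max_pos[OF c_ge_1 r] q_max_le_half[OF c_ge_1 r] by auto
    have q_le: "q_max c r V \<le> ?q"
      by (rule q_max_antimono[OF c_ge_1 r card_subset_V[OF S]])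
    have M2: "M2 I S \<subseteq> V"
      using I by (auto simp: M2_def)
    have mass_nonneg: "0 \<le> ?mass I S"
      using M2 by (intro sum_nonneg mass_nonneg) auto
    have nonneg: "0 \<le> (\<Sum>v\<in>M2 I S. (1 - ?q) ^ card (conflicts I S v))"
      using q by (intro sum_nonneg zero_le_power) auto
    \<comment> \<open>On a small sample the subtracted \<open>?n\<close> makes the left side
      nonpositive.\<close>
    have "card (M2 I S) - ?n * of_bool (?small S) - 2 * (1 / t) * ?mass I S \<le>
        (\<Sum>v\<in>M2 I S. (1 - ?q) ^ card (conflicts I S v))"
    proof (cases "?small S")
      case True
      moreover have "0 \<le> 2 * (1 / t) * ?mass I S"
        using t mass_nonneg by (intro mult_nonneg_nonneg) auto
      ultimately show ?thesis
        using nonneg card_subset_V[OF M2] by simp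
    next
      case False
      have "?n / 4 \<le> (c + 2) * (?n / (4 * (1 + c)))"
        using c_ge_1 n by (simp add: field_simps)
      also have "\<dots> \<le> n_tilde c S"
        unfolding n_tilde_def using False c_ge_1 by (intro mult_left_mono) auto
      finally have "?n / 4 \<le> n_tilde c S" .
      then have "t \<le> 3 * (1 + c)\<^sup>2 * (2 * log 2 (n_tilde c S) + 1)"
        unfolding t_def using n by (intro mult_left_mono add_right_mono) auto
      also have "\<dots> \<le> tau c r (n_tilde c S)"
        using n_tilde_ge_3[OF c_ge_1, of S] by (intro tau_ge c_ge_1 r) auto
      finally have "1 / tau c r (n_tilde c S) \<le> 1 / t"
        using t by (intro divide_left_mono) auto
      then have "?q * (4 * exp 1 * log 2 (n_tilde c S)) \<le> 1 / t"
        using le_q_max_mult[OF c_ge_1 r order_refl, of S] by linarith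
      then show ?thesis
        using survivors_ge[OF I, of ?q S "1 / t"] q log_n_tilde_pos[of S] False by simp
    qed
    then have "q_max c r V * (card (M2 I S) - ?n * of_bool (?small S) - 2 * (1 / t) * ?mass I S) \<le>
        q_max c r V * (\<Sum>v\<in>M2 I S. (1 - ?q) ^ card (conflicts I S v))"
      using q_max_pos[OF c_ge_1 r, of V] by (intro mult_left_mono) auto
    also have "\<dots> \<le> ?q * (\<Sum>v\<in>M2 I S. (1 - ?q) ^ card (conflicts I S v))"
      by (rule mult_right_mono[OF q_le nonneg])
    finally show "q_max c r V * (card (M2 I S) - ?n * of_bool (?small S) - 2 * (1 / t) * ?mass I S) \<le>
        ?q * (\<Sum>v\<in>M2 I S. (1 - ?q) ^ card (conflicts I S v))" .
  qed
  also have "\<dots> \<le> expected_output V w prec c D arr (q_max c r)"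
    using q_max_range[OF c_ge_1 r] by (rule expected_output_ge[OF arr])
  finally show ?thesis .
qed

text \<open>One constant serves both regimes: \<open>n0\<close> covers the graphs below the
  threshold, and the extra 2 gives the 1/4 above it.\<close>

lemma expected_output_q_max_ge:
  assumes V: "V \<noteq> {}" and arr: "arrival_order D arr" and r: "1 \<le> r"
    and large: "n0 \<le> card V \<Longrightarrow> card V * exp (- (card V / (4 * (1 + c)))) \<le> 1 / (4 * (1 + c))"
      "n0 \<le> card V \<Longrightarrow> 30 \<le> log 2 (card V)"
  shows "(1 / 2) ^ (n0 + 2) * q_max c r V * EM2 \<le> expected_output V w prec c D arr (q_max c r)"
proof -
  have nonneg: "0 \<le> q_max c r V * EM2"
    using q_max_pos[OF c_ge_1 r, of V] by (intro mult_nonneg_nonneg Ex_nonneg) auto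
  show ?thesis
  proof (cases "n0 \<le> card V")
    case True
    have "(1 / 2) ^ (n0 + 2) \<le> (1 / 4 :: real)"
      using power_decreasing[of 2 "n0 + 2" "1 / 2 :: real"] by (simp add: power2_eq_square)
    from mult_right_mono[OF this nonneg] show ?thesis
      using expected_output_q_max_ge_large[OF V arr r large[OF True]] by (simp only: mult.assoc)
  next
    case False
    have "(1 / 2) ^ (n0 + 2) \<le> (1 / 2 :: real) ^ card V"
      using False by (intro power_decreasing) auto
    from mult_right_mono[OF this nonneg] show ?thesis
      using expected_output_q_max_ge_small[OF arr r] by (simp only: mult.assoc)
  qed
qed

lemma expected_output_nonneg: "0 \<le> expected_output V w prec c D arr q"
  unfolding expected_output_def by (rule Bochner_Integration.integral_nonneg) simp

end

section \<open>Assembling the bound for constant \<open>q\<close> and the competitive ratio\<close>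

lemma ordered_graph_samplingI:
  assumes "graph_sampling V w c D" "inductive_order V w prec r"
  shows "ordered_graph_sampling V w c D prec"
  using assms
  by (auto simp: ordered_graph_sampling_def ordered_conflict_graph_def
      ordered_conflict_graph_axioms_def graph_sampling_def inductive_order_def)

theorem theorem15:
  fixes c :: real
  assumes "1 \<le> c"
  shows
    "(\<forall>(V :: 'a set) w prec D arr \<rho> q.
        graph_sampling V w c D \<longrightarrow>
        \<rho> = inductive_independence_number V w \<longrightarrow> 1 \<le> \<rho> \<longrightarrow>
        inductive_order V w prec \<rho> \<longrightarrow> arrival_order D arr \<longrightarrow>
        0 \<le> q \<longrightarrow> (\<forall>(I, S)\<in>set_pmf D. q \<le> q_max c \<rho> S) \<longrightarrow>
          expected_output V w prec c D arr (\<lambda>S. q) \<ge> 1 / c * (q / (4 * \<rho>) * expected_OPT_S w D) \<and>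
          ((\<forall>v\<in>V. measure_pmf.prob D {(I, S). v \<in> S} \<le> measure_pmf.prob D {(I, S). v \<in> I}) \<longrightarrow>
            expected_output V w prec c D arr (\<lambda>S. q) \<ge> q / (4 * \<rho>) * expected_OPT_S w D)) \<and>
     (\<exists>C > 0. \<forall>(V :: 'a set) w prec D arr \<rho>.
        graph_sampling V w c D \<longrightarrow> card V \<ge> 2 \<longrightarrow>
        \<rho> = inductive_independence_number V w \<longrightarrow> 1 \<le> \<rho> \<longrightarrow>
        inductive_order V w prec \<rho> \<longrightarrow> arrival_order D arr \<longrightarrow>
          expected_output V w prec c D arr (q_max c \<rho>) > 0 \<and>
          expected_OPT_I w D / expected_output V w prec c D arr (q_max c \<rho>)
            \<le> C * \<rho>\<^sup>2 * (log 2 (real (card V)))\<^sup>2)"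
proof (intro conjI allI impI)
  fix V :: "'a set" and w prec D arr q and \<rho> :: real
  assume gs: "graph_sampling V w c D" and rho: "1 \<le> \<rho>" and ord: "inductive_order V w prec \<rho>"
    and arr: "arrival_order D arr" and q: "0 \<le> q" and q_max: "\<forall>(I, S)\<in>set_pmf D. q \<le> q_max c \<rho> S"
  interpret ordered_graph_sampling V w c D prec
    using ordered_graph_samplingI[OF gs ord] .
  let ?out = "expected_output V w prec c D arr (\<lambda>S. q)"
  let ?M1 = "Ex (\<lambda>I S. real (card (M1 w prec S)))"
  have bound: "q / (4 * \<rho>) * expected_OPT_S w D \<le> q / 2 * ?M1"
    using mult_left_mono[OF expected_OPT_S_le[OF ord rho], of "q / (4 * \<rho>)"] q rho by simp
  have out: "q / 2 * EM2 \<le> ?out"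
  proof (cases "V = {}")
    case True
    then have "EM2 = 0"
      using card_V_ge_1 by (simp add: Ex_card_M2)
    then show ?thesis
      using expected_output_nonneg by simp
  next
    case False
    \<comment> \<open>The full sample carries the strongest restriction on \<open>q\<close>.\<close>
    obtain I where "(I, V) \<in> set_pmf D"
      using full_sample_possible by blast
    then have "q \<le> q_max c \<rho> V"
      using q_max by blast
    then show ?thesis
      using expected_output_constant_ge[OF False arr rho q] by blast
  qed
  have "q / 2 * ?M1 \<le> c * (q / 2 * EM2)"
    using mult_left_mono[OF Ex_card_M1_le_c_EM2, of "q / 2"] q by (simp add: mult_ac)
  also have "\<dots> \<le> c * ?out"
    using out assms by (intro mult_left_mono) auto
  finally have "q / (4 * \<rho>) * expected_OPT_S w D \<le> c * ?out"
    using bound by linarith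
  then have "1 / c * (q / (4 * \<rho>) * expected_OPT_S w D) \<le> 1 / c * (c * ?out)"
    using assms by (intro mult_left_mono) auto
  then show "1 / c * (q / (4 * \<rho>) * expected_OPT_S w D) \<le> ?out"
    using assms by simp
  assume "\<forall>v\<in>V. pS v \<le> pI v"
  then have "q / 2 * ?M1 \<le> q / 2 * EM2"
    using q by (intro mult_left_mono Ex_card_M1_le_EM2) auto
  then show "q / (4 * \<rho>) * expected_OPT_S w D \<le> ?out"
    using bound out by linarith
next
  \<comment> \<open>The threshold \<open>n0\<close> depends on \<open>c\<close> only, so the final
    constant is uniform over all graphs and laws.\<close>
  have "\<forall>\<^sub>F n in sequentially. real n * exp (- (real n / (4 * (1 + c)))) \<le> 1 / (4 * (1 + c)) \<and>
      30 \<le> log 2 (real n)"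
    using assms by (intro eventually_conj; real_asymp)
  then obtain n0 where n0: "\<And>n. n0 \<le> n \<Longrightarrow> real n * exp (- (real n / (4 * (1 + c)))) \<le> 1 / (4 * (1 + c))"
      "\<And>n. n0 \<le> n \<Longrightarrow> 30 \<le> log 2 (real n)"
    unfolding eventually_sequentially by blast
  define a where "a = log 2 (c + 2) + 1"
  define K where "K = 4 * exp 1 * a * ((3 * (1 + c) ^ 3 + c) / c) * (2 * a + 3)"
  \<comment> \<open>The factors stem from passing from \<open>V\<^sup>I\<close> to
    \<open>V\<^sup>S\<close>, from the optimum to \<open>M1\<close> to \<open>M2\<close>, from
    survival, and from \<open>1 / q_max\<close>. One power of \<rho> comes from charging, the other
    from \<open>tau\<close>.\<close>
  define C where "C = (1 + c) * (2 * c) * 2 ^ (n0 + 2) * K"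
  have "0 < a"
    using assms by (simp add: a_def add_nonneg_pos)
  then have "0 < K"
    using assms unfolding K_def by (intro mult_pos_pos divide_pos_pos add_pos_pos) auto
  then have "0 < C"
    using assms unfolding C_def by (intro mult_pos_pos) auto
  moreover have "expected_output V w prec c D arr (q_max c \<rho>) > 0 \<and>
      expected_OPT_I w D / expected_output V w prec c D arr (q_max c \<rho>)
        \<le> C * \<rho>\<^sup>2 * (log 2 (real (card V)))\<^sup>2"
    if gs: "graph_sampling V w c D" and V: "2 \<le> card V" and rho: "1 \<le> \<rho>"
      and ord: "inductive_order V w prec \<rho>" and arr: "arrival_order D arr"
    for V :: "'a set" and w prec D arr and \<rho> :: real
  proof -
    interpret ordered_graph_sampling V w c D prec
      using ordered_graph_samplingI[OF gs ord] .
    let ?out = "expected_output V w prec c D arr (q_max c \<rho>)"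
    let ?q = "q_max c \<rho> V"
    have "V \<noteq> {}"
      using V by auto
    have q: "0 < ?q"
      by (rule q_max_pos[OF assms rho])
    have "0 < 1 / (1 + c)"
      using assms by simp
    then have m: "0 < EM2"
      using Ex_card_M2_ge[OF \<open>V \<noteq> {}\<close>] by linarith
    have out: "(1 / 2) ^ (n0 + 2) * ?q * EM2 \<le> ?out"
      using expected_output_q_max_ge[OF \<open>V \<noteq> {}\<close> arr rho n0] .
    moreover have "0 < (1 / 2) ^ (n0 + 2) * ?q * EM2"
      using q m by simp
    ultimately have out_pos: "0 < ?out"
      by linarith
    have "EM2 = 2 ^ (n0 + 2) * (1 / ?q) * ((1 / 2) ^ (n0 + 2) * ?q * EM2)"
      using q by (simp add: power_divide)
    also have "\<dots> \<le> 2 ^ (n0 + 2) * (1 / ?q) * ?out"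
      using out q by (intro mult_left_mono) auto
    finally have M2_le: "EM2 \<le> 2 ^ (n0 + 2) * (1 / ?q) * ?out" .
    have "expected_OPT_I w D \<le> (1 + c) * (2 * \<rho> * (c * EM2))"
      using expected_OPT_I_le expected_OPT_S_le[OF ord rho] Ex_card_M1_le_c_EM2 assms rho
      by (smt (verit) mult_left_mono)
    also have "\<dots> \<le> (1 + c) * (2 * \<rho> * (c * (2 ^ (n0 + 2) * (1 / ?q) * ?out)))"
      using M2_le assms rho by (intro mult_left_mono) auto
    also have "\<dots> \<le> (1 + c) * (2 * \<rho> * (c * (2 ^ (n0 + 2) * (K * \<rho> * (log 2 (card V))\<^sup>2) * ?out)))"
      using inverse_q_max_le[OF assms rho V] assms rho out_pos
      by (intro mult_left_mono mult_right_mono) (auto simp: K_def a_def)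
    also have "\<dots> = C * \<rho>\<^sup>2 * (log 2 (card V))\<^sup>2 * ?out"
      by (simp add: C_def power2_eq_square mult_ac)
    finally show ?thesis
      using out_pos by (simp add: pos_divide_le_eq)
  qed
  ultimately show "\<exists>C > 0. \<forall>(V :: 'a set) w prec D arr \<rho>.
        graph_sampling V w c D \<longrightarrow> card V \<ge> 2 \<longrightarrow>
        \<rho> = inductive_independence_number V w \<longrightarrow> 1 \<le> \<rho> \<longrightarrow>
        inductive_order V w prec \<rho> \<longrightarrow> arrival_order D arr \<longrightarrow>
          expected_output V w prec c D arr (q_max c \<rho>) > 0 \<and>
          expected_OPT_I w D / expected_output V w prec c D arr (q_max c \<rho>)
            \<le> C * \<rho>\<^sup>2 * (log 2 (real (card V)))\<^sup>2"
    by blast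
qed

end
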